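(* Let $\mathcal{I}=\mathcal{I}\langle a_i,\varphi_i\rangle_{i<\omega}$ be a gradually fragmented ideal. Then there exist a function $b\in\omega^\omega$ with $b>0$ and a $\mathbb{D}$-name $\dot h$ for a non-decreasing function in $\omega^\omega$ converging to infinity such that the two-step iteration $\mathbb{D}\ast\mathbb{Q}^{\dot h}_b$ destroys every $\mathcal{I}$-Rothberger gap of the ground model: for every $\mathcal{I}$-orthogonal pair $\langle\mathcal{A},\mathcal{B}\rangle$ in the ground model with $\mathcal{A}$ countable, the extension contains a set $C\subseteq\omega$ separating $\langle\mathcal{A},\mathcal{B}\rangle$ with respect to $\mathcal{I}$.
   Context: A submeasure on a finite set $a$ is a map $\varphi:\mathcal{P}(a)\to[0,+\infty)$ with $\varphi(\varnothing)=0$, monotone, finitely subadditive. For a partition $\{a_i\}$ of $\omega$ into nonempty finite sets and submeasures $\varphi_i$ on $\mathcal{P}(a_i)$, $\mathcal{I}\langle a_i,\varphi_i\rangle_{i<\omega}=\{x\subseteq\omega: \{\varphi_i(x\cap a_i)\}_{i<\omega}\text{ bounded}\}$; it is gradually fragmented if for every $k<\omega$ there is $m<\omega$ such that for every $l<\omega$, for all but finitely many $i$, for every $B\subseteq\mathcal{P}(a_i)$ with $|B|\leq l$ and $\varphi_i(b)\leq k$ for $b\in B$, $\varphi_i(\bigcup B)\leq m$. A pair $\langle\mathcal{A},\mathcal{B}\rangle$ of families of subsets of $\omega$ is $\mathcal{I}$-orthogonal if $A\cap B\in\mathcal{I}$ for all $A\in\mathcal{A},B\in\mathcal{B}$; $C$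 separates it if $A\cap C\in\mathcal{I}$ for all $A\in\mathcal{A}$ and $B\smallsetminus C\in\mathcal{I}$ for all $B\in\mathcal{B}$. $\mathbb{D}$ is Hechler forcing: conditions $(s,f)$ with $s\in\omega^{<\omega}$, $f\in\omega^\omega$, $s\subseteq f$, ordered by $(t,g)\leq(s,f)$ iff $s\subseteq t$ and $f\leq g$ pointwise. For $b\in\omega^\omega$ with $b>0$ (identify $b(i)$ with $\{0,\dots,b(i)-1\}$) and non-decreasing $h\in\omega^\omega$, let $\mathbb{R}_b=\prod_{i<\omega}b(i)$, $S_n(b,h)=\prod_{i<n}[b(i)]^{\leq h(i)}$, $S_{<\omega}(b,h)=\bigcup_n S_n(b,h)$, and $\mathbb{Q}^h_b=\{(s,F): s\in S_{<\omega}(b,h),\ F\subseteq\mathbb{R}_b,\ |F|\leq h(|s|)\}$ ordered by $(s',F')\leq(s,F)$ iff $s\subseteq s'$, $F\subseteq F'$ and $\{x(i):x\in F\}\subseteq s'(i)$ for all $i\in[|s|,|s'|)$. In $\mathbb{D}\ast\mathbb{Q}^{\dot h}_b$, the second factor is $\mathbb{Q}^h_b$ as computed in the $\mathbb{D}$-extension with $h$ the interpretation of $\dot h$. *)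

theory Defs
  imports Complex_Main "HOL-Library.Countable_Set" "HOL-Library.Disjoint_Sets"
    "HOL-Library.Sublist"
begin

section \<open>Gradually fragmented ideals\<close>

definition finite_partition :: "(nat \<Rightarrow> nat set) \<Rightarrow> bool" where
  "finite_partition a \<longleftrightarrow>
     (\<forall>i. finite (a i) \<and> a i \<noteq> {}) \<and> disjoint_family a \<and> (\<Union>i. a i) = UNIV"

definition submeasure_on :: "nat set \<Rightarrow> (nat set \<Rightarrow> real) \<Rightarrow> bool" where
  "submeasure_on u \<mu> \<longleftrightarrow>
     \<mu> {} = 0 \<and>
     (\<forall>x. x \<subseteq> u \<longrightarrow> 0 \<le> \<mu> x) \<and>
     (\<forall>x y. x \<subseteq> y \<and> y \<subseteq> u \<longrightarrow> \<mu> x \<le> \<mu> y) \<and>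
     (\<forall>x y. x \<subseteq> u \<and> y \<subseteq> u \<longrightarrow> \<mu> (x \<union> y) \<le> \<mu> x + \<mu> y)"

definition frag_ideal :: "(nat \<Rightarrow> nat set) \<Rightarrow> (nat \<Rightarrow> nat set \<Rightarrow> real) \<Rightarrow> nat set set" where
  "frag_ideal a \<phi> = {x. bdd_above (range (\<lambda>i. \<phi> i (x \<inter> a i)))}"

definition gradually_fragmented :: "(nat \<Rightarrow> nat set) \<Rightarrow> (nat \<Rightarrow> nat set \<Rightarrow> real) \<Rightarrow> bool" where
  "gradually_fragmented a \<phi> \<longleftrightarrow>
     (\<forall>k::nat. \<exists>m::nat. \<forall>l::nat. \<forall>\<^sub>\<infinity>i.
        \<forall>B. B \<subseteq> Pow (a i) \<and> card B \<le> l \<and> (\<forall>x\<in>B. \<phi> i x \<le> real k)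
          \<longrightarrow> \<phi> i (\<Union>B) \<le> real m)"

definition orthogonal_wrt :: "nat set set \<Rightarrow> nat set set \<Rightarrow> nat set set \<Rightarrow> bool" where
  "orthogonal_wrt I \<A> \<B> \<longleftrightarrow> (\<forall>A\<in>\<A>. \<forall>B\<in>\<B>. A \<inter> B \<in> I)"


section \<open>Forcing\<close>

text \<open>
  The ground model is the ambient universe of HOL. A sentence about the extension is identified
  with the predicate \<open>p \<mapsto> (p forces it)\<close> on conditions, and the connectives and quantifiers
  below are the clauses of the recursive definition of the forcing relation. Smaller conditions
  are stronger.
\<close>

record 'p forcing =
  conds :: "'p set"
  le :: "'p \<Rightarrow> 'p \<Rightarrow> bool"

type_synonym 'p sentence = "'p \<Rightarrow> bool"

definition dense_below :: "'p forcing \<Rightarrow> 'p \<Rightarrow> 'p set \<Rightarrow> bool" where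
  "dense_below P p E \<longleftrightarrow>
     (\<forall>q\<in>conds P. le P q p \<longrightarrow> (\<exists>r\<in>conds P. le P r q \<and> r \<in> E))"

text \<open>A statement about ground model objects that is absolute between ground model and
  extension.\<close>

definition f_abs :: "bool \<Rightarrow> 'p sentence" where
  "f_abs c = (\<lambda>p. c)"

definition f_not :: "'p forcing \<Rightarrow> 'p sentence \<Rightarrow> 'p sentence" where
  "f_not P \<alpha> = (\<lambda>p. \<forall>q\<in>conds P. le P q p \<longrightarrow> \<not> \<alpha> q)"

definition f_and :: "'p sentence \<Rightarrow> 'p sentence \<Rightarrow> 'p sentence" where
  "f_and \<alpha> \<beta> = (\<lambda>p. \<alpha> p \<and> \<beta> p)"

definition f_imp :: "'p forcing \<Rightarrow> 'p sentence \<Rightarrow> 'p sentence \<Rightarrow> 'p sentence" where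
  "f_imp P \<alpha> \<beta> = (\<lambda>p. \<forall>q\<in>conds P. le P q p \<longrightarrow> \<alpha> q \<longrightarrow> \<beta> q)"

definition f_iff :: "'p forcing \<Rightarrow> 'p sentence \<Rightarrow> 'p sentence \<Rightarrow> 'p sentence" where
  "f_iff P \<alpha> \<beta> = f_and (f_imp P \<alpha> \<beta>) (f_imp P \<beta> \<alpha>)"

text \<open>The index set of a quantifier is either a set of names, or a ground model set, whose members
  are identified with their canonical names.\<close>

definition f_all :: "'x set \<Rightarrow> ('x \<Rightarrow> 'p sentence) \<Rightarrow> 'p sentence" where
  "f_all X \<Phi> = (\<lambda>p. \<forall>x\<in>X. \<Phi> x p)"

definition f_ex :: "'p forcing \<Rightarrow> 'x set \<Rightarrow> ('x \<Rightarrow> 'p sentence) \<Rightarrow> 'p sentence" where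
  "f_ex P X \<Phi> = (\<lambda>p. dense_below P p {q. \<exists>x\<in>X. \<Phi> x q})"

definition forced :: "'p forcing \<Rightarrow> 'p sentence \<Rightarrow> bool" where
  "forced P \<alpha> \<longleftrightarrow> (\<forall>p\<in>conds P. \<alpha> p)"


subsection \<open>Names\<close>

text \<open>
  Names are sets of pairs (name of an element, condition), as usual, but typed: \<open>names P X\<close> are the
  names whose first components come from \<open>X\<close>. Three instances are used. For a ground model set
  \<open>X\<close> (canonical names), these are the names for subsets of \<open>X\<close>. In particular, the members of
  \<open>real_names P\<close> are names for subsets of \<open>\<omega> \<times> \<omega>\<close>, hence among them for (graphs of) elements of
  \<open>\<omega>\<^sup>\<omega>\<close>. Finally, \<open>names P (real_names P)\<close> are names for sets of subsets of \<open>\<omega> \<times> \<omega>\<close>.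
\<close>

type_synonym ('x, 'p) name = "('x \<times> 'p) set"

type_synonym 'p real_name = "(nat \<times> nat, 'p) name"

definition names :: "'p forcing \<Rightarrow> 'x set \<Rightarrow> ('x, 'p) name set" where
  "names P X = Pow (X \<times> conds P)"

abbreviation real_names :: "'p forcing \<Rightarrow> 'p real_name set" where
  "real_names P \<equiv> names P UNIV"

definition f_mem :: "'p forcing \<Rightarrow> 'x \<Rightarrow> ('x, 'p) name \<Rightarrow> 'p sentence" where
  "f_mem P x \<tau> = (\<lambda>p. dense_below P p {q. \<exists>r. (x, r) \<in> \<tau> \<and> le P q r})"

definition f_eq :: "'p forcing \<Rightarrow> ('x, 'p) name \<Rightarrow> ('x, 'p) name \<Rightarrow> 'p sentence" where
  "f_eq P \<sigma> \<tau> = f_all UNIV (\<lambda>x. f_iff P (f_mem P x \<sigma>) (f_mem P x \<tau>))"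

definition f_mem_set :: "'p forcing \<Rightarrow> 'p real_name \<Rightarrow> ('p real_name, 'p) name \<Rightarrow> 'p sentence" where
  "f_mem_set P x F =
     (\<lambda>p. dense_below P p {q. \<exists>y r. (y, r) \<in> F \<and> le P q r \<and> f_eq P x y q})"

text \<open>An element of a ground model set is named by a name for its singleton: \<open>f_val P \<tau> x\<close> says
  \<open>\<tau> = {x}\<close>.\<close>

definition f_val :: "'p forcing \<Rightarrow> ('x, 'p) name \<Rightarrow> 'x \<Rightarrow> 'p sentence" where
  "f_val P \<tau> x = f_all UNIV (\<lambda>y. f_iff P (f_mem P y \<tau>) (f_abs (y = x)))"


subsection \<open>Functions in \<open>\<omega>\<^sup>\<omega>\<close>\<close>

definition f_fun :: "'p forcing \<Rightarrow> 'p real_name \<Rightarrow> 'p sentence" where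
  "f_fun P h = f_all UNIV (\<lambda>n. f_ex P UNIV (\<lambda>k. f_all UNIV (\<lambda>j.
     f_iff P (f_mem P (n, j) h) (f_abs (j = k)))))"

definition f_nondecreasing :: "'p forcing \<Rightarrow> 'p real_name \<Rightarrow> 'p sentence" where
  "f_nondecreasing P h = f_all {(i, j). i \<le> j} (\<lambda>(i, j). f_all UNIV (\<lambda>(k, l).
     f_imp P (f_and (f_mem P (i, k) h) (f_mem P (j, l) h)) (f_abs (k \<le> l))))"

definition f_to_infinity :: "'p forcing \<Rightarrow> 'p real_name \<Rightarrow> 'p sentence" where
  "f_to_infinity P h = f_all UNIV (\<lambda>N. f_ex P UNIV (\<lambda>n. f_all {n..} (\<lambda>i. f_all UNIV (\<lambda>k.
     f_imp P (f_mem P (i, k) h) (f_abs (N \<le> k))))))"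

text \<open>\<open>x\<close> belongs to the product of the sets \<open>{0, \<dots>, b(i) - 1}\<close> as computed in the extension.\<close>

definition f_in_R :: "'p forcing \<Rightarrow> (nat \<Rightarrow> nat) \<Rightarrow> 'p real_name \<Rightarrow> 'p sentence" where
  "f_in_R P b x = f_and (f_fun P x)
     (f_all UNIV (\<lambda>(i, k). f_imp P (f_mem P (i, k) x) (f_abs (k < b i))))"


section \<open>Hechler forcing\<close>

definition hechler :: "(nat list \<times> (nat \<Rightarrow> nat)) forcing" where
  "hechler = \<lparr>
     conds = {(s, f). \<forall>i<length s. s ! i = f i},
     le = (\<lambda>(t, g) (s, f). prefix s t \<and> (\<forall>n. f n \<le> g n)) \<rparr>"


section \<open>The slalom forcing as computed in an extension\<close>

text \<open>A finite sequence of finite sets of naturals is a ground model object; \<open>s\<close> has the \<open>i\<close>-th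
  entry \<open>s ! i\<close>.\<close>

definition f_in_S ::
  "'p forcing \<Rightarrow> (nat \<Rightarrow> nat) \<Rightarrow> 'p real_name \<Rightarrow> nat set list \<Rightarrow> 'p sentence" where
  "f_in_S P b h s = f_all {..<length s} (\<lambda>i. f_and (f_abs (s ! i \<subseteq> {..<b i}))
     (f_ex P UNIV (\<lambda>k. f_and (f_mem P (i, k) h) (f_abs (card (s ! i) \<le> k)))))"

text \<open>\<open>F = {x\<^sub>0, \<dots>, x\<^sub>m\<^sub>-\<^sub>1}\<close> for some \<open>m \<le> n\<close>. A finite sequence in the extension is given by a
  ground model list of names.\<close>

definition f_card_le :: "'p forcing \<Rightarrow> ('p real_name, 'p) name \<Rightarrow> nat \<Rightarrow> 'p sentence" where
  "f_card_le P F n = f_ex P {xs. length xs \<le> n \<and> set xs \<subseteq> real_names P} (\<lambda>xs.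
     f_all (real_names P) (\<lambda>x. f_iff P (f_mem_set P x F) (f_ex P (set xs) (\<lambda>y. f_eq P x y))))"

text \<open>A name for a pair \<open>(s, F)\<close> is a pair of names.\<close>

type_synonym 'p slalom_name = "(nat set list, 'p) name \<times> ('p real_name, 'p) name"

definition slalom_names :: "'p forcing \<Rightarrow> 'p slalom_name set" where
  "slalom_names P = names P UNIV \<times> names P (real_names P)"

definition f_in_Q ::
  "'p forcing \<Rightarrow> (nat \<Rightarrow> nat) \<Rightarrow> 'p real_name \<Rightarrow> 'p slalom_name \<Rightarrow> 'p sentence" where
  "f_in_Q P b h = (\<lambda>(\<sigma>, F). f_ex P UNIV (\<lambda>s.
     f_and (f_val P \<sigma> s)
    (f_and (f_in_S P b h s)
    (f_and (f_all (real_names P) (\<lambda>x. f_imp P (f_mem_set P x F) (f_in_R P b x)))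
           (f_ex P UNIV (\<lambda>k. f_and (f_mem P (length s, k) h) (f_card_le P F k)))))))"

definition f_le_Q :: "'p forcing \<Rightarrow> 'p slalom_name \<Rightarrow> 'p slalom_name \<Rightarrow> 'p sentence" where
  "f_le_Q P = (\<lambda>(\<sigma>', F') (\<sigma>, F). f_ex P UNIV (\<lambda>s'. f_ex P UNIV (\<lambda>s.
     f_and (f_val P \<sigma>' s')
    (f_and (f_val P \<sigma> s)
    (f_and (f_abs (prefix s s'))
    (f_and (f_all (real_names P) (\<lambda>x. f_imp P (f_mem_set P x F) (f_mem_set P x F')))
           (f_all {length s..<length s'} (\<lambda>i. f_all (real_names P) (\<lambda>x. f_all UNIV (\<lambda>k.
              f_imp P (f_and (f_mem_set P x F) (f_mem P (i, k) x)) (f_abs (k \<in> s' ! i))))))))))))"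


section \<open>Two-step iteration\<close>

text \<open>The second factor is given by a set \<open>N\<close> of \<open>P\<close>-names for its potential elements and by the
  formulas defining its underlying set and its order in the \<open>P\<close>-extension.\<close>

definition two_step ::
  "'p forcing \<Rightarrow> 'q set \<Rightarrow> ('q \<Rightarrow> 'p sentence) \<Rightarrow> ('q \<Rightarrow> 'q \<Rightarrow> 'p sentence) \<Rightarrow> ('p \<times> 'q) forcing"
where
  "two_step P N in_Q le_Q = \<lparr>
     conds = {(p, q). p \<in> conds P \<and> q \<in> N \<and> in_Q q p},
     le = (\<lambda>(p', q') (p, q). le P p' p \<and> le_Q q' q p') \<rparr>"

abbreviation hechler_slalom where
  "hechler_slalom b h \<equiv>
     two_step hechler (slalom_names hechler) (f_in_Q hechler b h) (f_le_Q hechler)"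


section \<open>Separation in an extension\<close>

text \<open>
  \<open>X n\<close> is the sentence \<open>n \<in> X\<close> for a set \<open>X \<subseteq> \<omega>\<close> of the extension. Since \<open>a i\<close> is finite,
  \<open>X \<inter> a i\<close> is one of the ground model sets \<open>y \<subseteq> a i\<close>; and a sequence of nonnegative reals of
  the extension is bounded iff it is bounded by a natural number \<open>K\<close>.
\<close>

definition f_in_ideal ::
  "'p forcing \<Rightarrow> (nat \<Rightarrow> nat set) \<Rightarrow> (nat \<Rightarrow> nat set \<Rightarrow> real) \<Rightarrow> (nat \<Rightarrow> 'p sentence) \<Rightarrow> 'p sentence"
where
  "f_in_ideal P a \<phi> X = f_ex P UNIV (\<lambda>K::nat. f_all UNIV (\<lambda>i. f_ex P (Pow (a i)) (\<lambda>y.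
     f_and (f_all (a i) (\<lambda>n. f_iff P (X n) (f_abs (n \<in> y)))) (f_abs (\<phi> i y \<le> real K)))))"

definition f_separates ::
  "'p forcing \<Rightarrow> (nat \<Rightarrow> nat set) \<Rightarrow> (nat \<Rightarrow> nat set \<Rightarrow> real) \<Rightarrow> nat set set \<Rightarrow> nat set set
     \<Rightarrow> (nat, 'p) name \<Rightarrow> 'p sentence" where
  "f_separates P a \<phi> \<A> \<B> C = f_and
     (f_all \<A> (\<lambda>A. f_in_ideal P a \<phi> (\<lambda>n. f_and (f_abs (n \<in> A)) (f_mem P n C))))
     (f_all \<B> (\<lambda>B. f_in_ideal P a \<phi> (\<lambda>n. f_and (f_abs (n \<in> B)) (f_not P (f_mem P n C)))))"

end

theory Submission
  imports Defs
begin

text \<open>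
  The generic slalom captures every ground model real of \<open>\<real>\<^sub>b\<close>, where \<open>b(i)\<close> bounds the codes of the
  subsets of \<open>a i\<close>. Let \<open>A\<^sub>0, A\<^sub>1, \<dots>\<close> enumerate \<open>\<A>\<close>, let \<open>d\<close> be the Hechler real and \<open>S\<close> the generic
  slalom, and let \<open>C \<inter> a i\<close> be the union of those \<open>y \<subseteq> a i\<close> coded in \<open>S(i)\<close> with
  \<open>\<phi>\<^sub>i(A\<^sub>j \<inter> y) \<le> d(j)\<close> for all \<open>j \<le> i\<close>. Then \<open>A\<^sub>j \<inter> C \<inter> a i\<close> is a union of at most \<open>h(i)\<close> sets of
  submeasure at most \<open>d(j)\<close>, which gradual fragmentation bounds independently of \<open>i\<close> if \<open>h\<close> grows
  slowly enough; such an \<open>h\<close> exists already in the ground model. For \<open>B \<in> \<B>\<close>, \<open>d\<close> dominates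
  \<open>j \<mapsto> sup\<^sub>i \<phi>\<^sub>i(A\<^sub>j \<inter> B \<inter> a i)\<close> from some \<open>n\<close> on, so the pieces of
  \<open>B' = B - (A\<^sub>0 \<union> \<dots> \<union> A\<^sub>n\<^sub>-\<^sub>1)\<close> pass the test and are captured by \<open>S\<close> at almost all \<open>i\<close>, while
  \<open>B - B'\<close> belongs to the ideal by orthogonality.
\<close>

section \<open>Forcing over a preorder\<close>

definition stronger :: "'p forcing \<Rightarrow> 'p \<Rightarrow> 'p \<Rightarrow> bool"  (infix "\<preceq>\<index>" 50) where
  "q \<preceq>\<^bsub>P\<^esub> p \<longleftrightarrow> q \<in> conds P \<and> le P q p"

lemma stronger_in_conds: "q \<preceq>\<^bsub>P\<^esub> p \<Longrightarrow> q \<in> conds P"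
  by (simp add: stronger_def)

lemma dense_below_iff: "dense_below P p E \<longleftrightarrow> (\<forall>q. q \<preceq>\<^bsub>P\<^esub> p \<longrightarrow> (\<exists>r. r \<preceq>\<^bsub>P\<^esub> q \<and> r \<in> E))"
  by (auto simp: dense_below_def stronger_def)

lemma forces_simps:
  "f_abs c p \<longleftrightarrow> c"
  "f_and \<alpha> \<beta> p \<longleftrightarrow> \<alpha> p \<and> \<beta> p"
  "f_not P \<alpha> p \<longleftrightarrow> (\<forall>q. q \<preceq>\<^bsub>P\<^esub> p \<longrightarrow> \<not> \<alpha> q)"
  "f_imp P \<alpha> \<beta> p \<longleftrightarrow> (\<forall>q. q \<preceq>\<^bsub>P\<^esub> p \<longrightarrow> \<alpha> q \<longrightarrow> \<beta> q)"
  "f_iff P \<alpha> \<beta> p \<longleftrightarrow> (\<forall>q. q \<preceq>\<^bsub>P\<^esub> p \<longrightarrow> (\<alpha> q \<longleftrightarrow> \<beta> q))"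
  "f_all X \<Phi> p \<longleftrightarrow> (\<forall>x\<in>X. \<Phi> x p)"
  by (auto simp: f_abs_def f_and_def f_not_def f_imp_def f_iff_def f_all_def stronger_def)

lemma f_andI: "\<alpha> p \<Longrightarrow> \<beta> p \<Longrightarrow> f_and \<alpha> \<beta> p"
  by (simp add: f_and_def)

lemma f_allI: "(\<And>x. x \<in> X \<Longrightarrow> \<Phi> x p) \<Longrightarrow> f_all X \<Phi> p"
  by (simp add: f_all_def)

lemma f_ex_iff: "f_ex P X \<Phi> p \<longleftrightarrow> (\<forall>q. q \<preceq>\<^bsub>P\<^esub> p \<longrightarrow> (\<exists>r. r \<preceq>\<^bsub>P\<^esub> q \<and> (\<exists>x\<in>X. \<Phi> x r)))"
  by (simp add: f_ex_def dense_below_iff)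

text \<open>That is, the set of conditions satisfying the sentence is regular open.\<close>

definition regular_sentence :: "'p forcing \<Rightarrow> 'p sentence \<Rightarrow> bool" where
  "regular_sentence P \<alpha> \<longleftrightarrow>
     (\<forall>p q. q \<preceq>\<^bsub>P\<^esub> p \<longrightarrow> \<alpha> p \<longrightarrow> \<alpha> q) \<and>
     (\<forall>p\<in>conds P. (\<forall>q. q \<preceq>\<^bsub>P\<^esub> p \<longrightarrow> (\<exists>r. r \<preceq>\<^bsub>P\<^esub> q \<and> \<alpha> r)) \<longrightarrow> \<alpha> p)"

lemma regular_sentenceI:
  assumes "\<And>p q. q \<preceq>\<^bsub>P\<^esub> p \<Longrightarrow> \<alpha> p \<Longrightarrow> \<alpha> q"
    and "\<And>p. p \<in> conds P \<Longrightarrow> (\<And>q. q \<preceq>\<^bsub>P\<^esub> p \<Longrightarrow> \<exists>r. r \<preceq>\<^bsub>P\<^esub> q \<and> \<alpha> r) \<Longrightarrow> \<alpha> p"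
  shows "regular_sentence P \<alpha>"
  using assms unfolding regular_sentence_def by metis

lemma regular_sentence_stronger:
  "regular_sentence P \<alpha> \<Longrightarrow> \<alpha> p \<Longrightarrow> q \<preceq>\<^bsub>P\<^esub> p \<Longrightarrow> \<alpha> q"
  by (auto simp: regular_sentence_def)

lemma regular_sentence_dense:
  assumes "regular_sentence P \<alpha>" "p \<in> conds P" "\<And>q. q \<preceq>\<^bsub>P\<^esub> p \<Longrightarrow> \<exists>r. r \<preceq>\<^bsub>P\<^esub> q \<and> \<alpha> r"
  shows "\<alpha> p"
  using assms by (auto simp: regular_sentence_def)

definition check_name :: "'p forcing \<Rightarrow> 'x set \<Rightarrow> ('x, 'p) name" where
  "check_name P X = X \<times> conds P"

definition fun_name :: "'p forcing \<Rightarrow> (nat \<Rightarrow> nat) \<Rightarrow> 'p real_name" where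
  "fun_name P x = check_name P (range (\<lambda>i. (i, x i)))"

definition f_value :: "'p forcing \<Rightarrow> 'p real_name \<Rightarrow> nat \<Rightarrow> nat \<Rightarrow> 'p sentence" where
  "f_value P x n k = f_all UNIV (\<lambda>j. f_iff P (f_mem P (n, j) x) (f_abs (j = k)))"

lemma check_name_in_names: "X \<subseteq> Y \<Longrightarrow> check_name P X \<in> names P Y"
  by (auto simp: check_name_def names_def)

lemma fun_name_in_names: "fun_name P x \<in> real_names P"
  by (simp add: fun_name_def check_name_in_names)

locale preordered_forcing =
  fixes P :: "'p forcing"
  assumes stronger_refl: "p \<in> conds P \<Longrightarrow> p \<preceq>\<^bsub>P\<^esub> p"
    and stronger_trans: "r \<preceq>\<^bsub>P\<^esub> q \<Longrightarrow> q \<preceq>\<^bsub>P\<^esub> p \<Longrightarrow> r \<preceq>\<^bsub>P\<^esub> p"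
begin

lemma f_exE:
  assumes "f_ex P X \<Phi> p" "p \<in> conds P"
  obtains q x where "q \<preceq>\<^bsub>P\<^esub> p" "x \<in> X" "\<Phi> x q"
  using assms stronger_refl stronger_trans unfolding f_ex_iff by blast

lemma f_exI:
  assumes "x \<in> X" "\<Phi> x p" "regular_sentence P (\<Phi> x)"
  shows "f_ex P X \<Phi> p"
  using assms stronger_refl stronger_in_conds regular_sentence_stronger unfolding f_ex_iff by metis

lemma f_ex_elim_regular:
  assumes "f_ex P X \<Phi> p" "p \<in> conds P" "regular_sentence P \<beta>"
    and "\<And>q x. q \<preceq>\<^bsub>P\<^esub> p \<Longrightarrow> x \<in> X \<Longrightarrow> \<Phi> x q \<Longrightarrow> \<beta> q"
  shows "\<beta> p"
  using assms(3,2)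
proof (rule regular_sentence_dense)
  fix q assume "q \<preceq>\<^bsub>P\<^esub> p"
  then show "\<exists>r. r \<preceq>\<^bsub>P\<^esub> q \<and> \<beta> r"
    using assms(1,4) stronger_trans unfolding f_ex_iff by metis
qed

lemma f_ex_cong:
  assumes "\<And>q x. q \<preceq>\<^bsub>P\<^esub> p \<Longrightarrow> x \<in> X \<Longrightarrow> \<Phi> x q \<longleftrightarrow> \<Psi> x q"
  shows "f_ex P X \<Phi> p \<longleftrightarrow> f_ex P X \<Psi> p"
  using assms stronger_trans unfolding f_ex_iff by metis

lemma regular_dense_below: "regular_sentence P (\<lambda>p. dense_below P p E)"
  unfolding regular_sentence_def dense_below_iff
  using stronger_refl stronger_in_conds stronger_trans by metis

lemma regular_f_abs: "regular_sentence P (f_abs c)"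
  using stronger_refl by (auto simp: regular_sentence_def forces_simps)

lemma regular_f_all:
  assumes "\<And>x. x \<in> X \<Longrightarrow> regular_sentence P (\<Phi> x)"
  shows "regular_sentence P (f_all X \<Phi>)"
proof (rule regular_sentenceI)
  fix p q assume "q \<preceq>\<^bsub>P\<^esub> p" "f_all X \<Phi> p"
  then show "f_all X \<Phi> q"
    using regular_sentence_stronger[OF assms] unfolding forces_simps by metis
next
  fix p assume p: "p \<in> conds P" "\<And>q. q \<preceq>\<^bsub>P\<^esub> p \<Longrightarrow> \<exists>r. r \<preceq>\<^bsub>P\<^esub> q \<and> f_all X \<Phi> r"
  have "\<Phi> x p" if "x \<in> X" for x
    using assms[OF that] p(1)
    by (rule regular_sentence_dense) (use p(2) that in \<open>force simp: forces_simps\<close>)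
  then show "f_all X \<Phi> p" by (simp add: forces_simps)
qed

lemma regular_f_and:
  assumes "regular_sentence P \<alpha>" "regular_sentence P \<beta>"
  shows "regular_sentence P (f_and \<alpha> \<beta>)"
proof -
  have "f_and \<alpha> \<beta> = f_all {\<alpha>, \<beta>} (\<lambda>\<gamma>. \<gamma>)" by (auto simp: fun_eq_iff forces_simps)
  then show ?thesis using assms regular_f_all[of "{\<alpha>, \<beta>}" "\<lambda>\<gamma>. \<gamma>"] by auto
qed

lemma regular_f_imp:
  assumes "regular_sentence P \<alpha>" "regular_sentence P \<beta>"
  shows "regular_sentence P (f_imp P \<alpha> \<beta>)"
proof (rule regular_sentenceI)
  fix p q assume "q \<preceq>\<^bsub>P\<^esub> p" "f_imp P \<alpha> \<beta> p"
  then show "f_imp P \<alpha> \<beta> q"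
    unfolding forces_simps by (meson stronger_trans)
next
  fix p assume dense: "\<And>q. q \<preceq>\<^bsub>P\<^esub> p \<Longrightarrow> \<exists>r. r \<preceq>\<^bsub>P\<^esub> q \<and> f_imp P \<alpha> \<beta> r"
  have "\<beta> q" if q: "q \<preceq>\<^bsub>P\<^esub> p" "\<alpha> q" for q
  proof (rule regular_sentence_dense[OF assms(2) stronger_in_conds[OF q(1)]])
    fix r assume r: "r \<preceq>\<^bsub>P\<^esub> q"
    then obtain u where u: "u \<preceq>\<^bsub>P\<^esub> r" "f_imp P \<alpha> \<beta> u"
      using dense q(1) stronger_trans by blast
    then have "\<alpha> u"
      using regular_sentence_stronger[OF assms(1) q(2)] r stronger_trans by blast
    then show "\<exists>u. u \<preceq>\<^bsub>P\<^esub> r \<and> \<beta> u"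
      using u stronger_refl[OF stronger_in_conds[OF u(1)]] by (auto simp: forces_simps)
  qed
  then show "f_imp P \<alpha> \<beta> p" by (simp add: forces_simps)
qed

lemma regular_f_iff:
  "regular_sentence P \<alpha> \<Longrightarrow> regular_sentence P \<beta> \<Longrightarrow> regular_sentence P (f_iff P \<alpha> \<beta>)"
  unfolding f_iff_def by (intro regular_f_and regular_f_imp)

lemma regular_f_ex: "regular_sentence P (f_ex P X \<Phi>)"
  unfolding f_ex_def by (rule regular_dense_below)

lemma regular_f_mem: "regular_sentence P (f_mem P x \<tau>)"
  unfolding f_mem_def by (rule regular_dense_below)

lemma regular_f_mem_set: "regular_sentence P (f_mem_set P x F)"
  unfolding f_mem_set_def by (rule regular_dense_below)

lemmas regular_intros = regular_f_abs regular_f_and regular_f_imp regular_f_iff regular_f_all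
  regular_f_ex regular_f_mem regular_f_mem_set

lemma regular_f_eq: "regular_sentence P (f_eq P \<sigma> \<tau>)"
  unfolding f_eq_def by (intro regular_intros)

lemma regular_f_val: "regular_sentence P (f_val P \<tau> x)"
  unfolding f_val_def by (intro regular_intros)

lemma f_ex_unique_iff:
  assumes "p \<in> conds P" "x \<in> X" "\<alpha> x p"
    and regular: "regular_sentence P (\<alpha> x)" "regular_sentence P (\<Phi> x)"
    and unique: "\<And>q y. q \<preceq>\<^bsub>P\<^esub> p \<Longrightarrow> y \<in> X \<Longrightarrow> \<alpha> y q \<Longrightarrow> y = x"
  shows "f_ex P X (\<lambda>x. f_and (\<alpha> x) (\<Phi> x)) p \<longleftrightarrow> \<Phi> x p"
proof
  assume "f_ex P X (\<lambda>x. f_and (\<alpha> x) (\<Phi> x)) p"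
  then show "\<Phi> x p"
    using assms(1) regular(2) by (rule f_ex_elim_regular) (use unique in \<open>auto simp: forces_simps\<close>)
next
  assume "\<Phi> x p"
  then show "f_ex P X (\<lambda>x. f_and (\<alpha> x) (\<Phi> x)) p"
    using assms by (intro f_exI[of x] regular_f_and) (auto simp: forces_simps)
qed

lemma f_ex_finite_choice:
  assumes "finite X" "p \<in> conds P" "\<And>x. x \<in> X \<Longrightarrow> f_ex P UNIV (\<Phi> x) p"
    and regular: "\<And>x y. regular_sentence P (\<Phi> x y)"
  obtains q v where "q \<preceq>\<^bsub>P\<^esub> p" "\<forall>x\<in>X. \<Phi> x (v x) q"
proof -
  have "\<exists>q v. q \<preceq>\<^bsub>P\<^esub> p \<and> (\<forall>x\<in>X. \<Phi> x (v x) q)"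
    using assms(1,3)
  proof (induction X rule: finite_induct)
    case empty
    then show ?case using stronger_refl[OF assms(2)] by auto
  next
    case (insert x X)
    then obtain q v where q: "q \<preceq>\<^bsub>P\<^esub> p" "\<forall>x\<in>X. \<Phi> x (v x) q" by auto
    have "f_ex P UNIV (\<Phi> x) q"
      using insert.prems q(1) regular_sentence_stronger[OF regular_f_ex] by blast
    then obtain r y where r: "r \<preceq>\<^bsub>P\<^esub> q" "\<Phi> x y r"
      using stronger_in_conds[OF q(1)] by (auto elim: f_exE)
    have "\<forall>z\<in>insert x X. \<Phi> z ((v(x := y)) z) r"
      using q(2) r regular_sentence_stronger[OF regular] by auto
    then show ?case using stronger_trans[OF r(1) q(1)] by blast
  qed
  then show ?thesis using that by blast
qed

lemma f_mem_check_name: "p \<in> conds P \<Longrightarrow> f_mem P x (check_name P X) p \<longleftrightarrow> x \<in> X"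
  using stronger_refl by (auto simp: f_mem_def check_name_def dense_below_def stronger_def)

lemma f_mem_fun_name: "p \<in> conds P \<Longrightarrow> f_mem P (i, k) (fun_name P x) p \<longleftrightarrow> k = x i"
  by (auto simp: fun_name_def f_mem_check_name)

lemma f_val_check_name: "f_val P (check_name P {x}) x p"
  by (simp add: f_val_def forces_simps f_mem_check_name stronger_in_conds)

lemma f_val_unique: "p \<in> conds P \<Longrightarrow> f_val P \<tau> x p \<Longrightarrow> f_val P \<tau> y p \<Longrightarrow> x = y"
  using stronger_refl by (auto simp: f_val_def forces_simps)

lemma f_eq_refl: "f_eq P x x p"
  by (simp add: f_eq_def forces_simps)

lemma f_eqD: "f_eq P x y p \<Longrightarrow> q \<preceq>\<^bsub>P\<^esub> p \<Longrightarrow> f_mem P z x q \<longleftrightarrow> f_mem P z y q"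
  by (simp add: f_eq_def forces_simps)

lemma f_mem_set_check_name: "f_mem_set P x (check_name P Y) p \<longleftrightarrow> f_ex P Y (f_eq P x) p"
proof -
  have "(\<exists>y u. (y, u) \<in> check_name P Y \<and> le P q u \<and> f_eq P x y q) \<longleftrightarrow> (\<exists>y\<in>Y. f_eq P x y q)"
    if "q \<in> conds P" for q
    using that stronger_refl[OF that] by (auto simp: check_name_def stronger_def)
  then show ?thesis
    unfolding f_mem_set_def f_ex_def dense_below_def by simp
qed

lemma f_mem_set_check_nameI: "x \<in> Y \<Longrightarrow> f_mem_set P x (check_name P Y) p"
  unfolding f_mem_set_check_name by (intro f_exI[of x] f_eq_refl regular_f_eq)

lemma f_mem_set_check_name_mono:
  assumes "Y \<subseteq> Z" "f_mem_set P x (check_name P Y) p"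
  shows "f_mem_set P x (check_name P Z) p"
  using assms unfolding f_mem_set_check_name f_ex_iff by (meson subsetD)

lemma f_fun_eq: "f_fun P x = f_all UNIV (\<lambda>n. f_ex P UNIV (f_value P x n))"
  by (simp add: f_fun_def f_value_def[abs_def])

lemma f_valueD: "f_value P x n k p \<Longrightarrow> q \<preceq>\<^bsub>P\<^esub> p \<Longrightarrow> f_mem P (n, j) x q \<longleftrightarrow> j = k"
  by (simp add: f_value_def forces_simps)

lemma f_value_fun_name: "f_value P (fun_name P x) n (x n) p"
  by (simp add: f_value_def forces_simps f_mem_fun_name stronger_in_conds)

lemma regular_f_value: "regular_sentence P (f_value P x n k)"
  unfolding f_value_def by (intro regular_intros)

lemma regular_f_in_R: "regular_sentence P (f_in_R P b x)"
  unfolding f_in_R_def f_fun_eq by (auto intro!: regular_intros split: prod.split)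

lemma f_fun_fun_name: "f_fun P (fun_name P x) p"
  unfolding f_fun_eq
  by (intro f_allI f_exI[where \<Phi> = "f_value P (fun_name P x) _", OF _ f_value_fun_name]
      regular_f_value UNIV_I)

lemma f_in_R_fun_name: "(\<And>i. x i < b i) \<Longrightarrow> f_in_R P b (fun_name P x) p"
  by (auto simp: f_in_R_def f_fun_fun_name forces_simps f_mem_fun_name stronger_in_conds)

lemma f_in_R_value_less:
  assumes "p \<in> conds P" "f_in_R P b x p" "f_value P x n k p"
  shows "k < b n"
  using assms stronger_refl[OF assms(1)] f_valueD[OF assms(3), of p k]
  by (auto simp: f_in_R_def forces_simps)

lemma f_in_R_cong:
  assumes "f_eq P x y p"
  shows "f_in_R P b x p \<longleftrightarrow> f_in_R P b y p"
proof -
  have mem: "f_mem P z x q \<longleftrightarrow> f_mem P z y q" if "q \<preceq>\<^bsub>P\<^esub> p" for z q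
    using f_eqD[OF assms that] .
  have "f_value P x n k q \<longleftrightarrow> f_value P y n k q" if q: "q \<preceq>\<^bsub>P\<^esub> p" for n k q
    using mem[OF stronger_trans[OF _ q]] by (simp add: f_value_def forces_simps)
  then have "f_ex P UNIV (f_value P x n) p \<longleftrightarrow> f_ex P UNIV (f_value P y n) p" for n
    by (rule f_ex_cong)
  then show ?thesis
    by (simp add: f_in_R_def f_fun_eq forces_simps mem split_beta)
qed

lemma f_nondecreasing_fun_name: "mono x \<Longrightarrow> f_nondecreasing P (fun_name P x) p"
  by (auto simp: f_nondecreasing_def forces_simps f_mem_fun_name stronger_in_conds monoD)

lemma f_to_infinity_fun_name:
  assumes "filterlim x at_top sequentially"
  shows "f_to_infinity P (fun_name P x) p"
  unfolding f_to_infinity_def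
proof (rule f_allI)
  fix N
  obtain n where "\<forall>i\<ge>n. N \<le> x i"
    using assms by (auto simp: filterlim_at_top eventually_sequentially)
  then show "f_ex P UNIV (\<lambda>n. f_all {n..} (\<lambda>i. f_all UNIV (\<lambda>k.
      f_imp P (f_mem P (i, k) (fun_name P x)) (f_abs (N \<le> k))))) p"
    by (intro f_exI[of n] regular_intros)
      (auto simp: forces_simps f_mem_fun_name stronger_in_conds)
qed

end

section \<open>The slalom forcing of an extension\<close>

definition f_subset ::
  "'p forcing \<Rightarrow> ('p real_name, 'p) name \<Rightarrow> ('p real_name, 'p) name \<Rightarrow> 'p sentence" where
  "f_subset P F F' =
     f_all (real_names P) (\<lambda>x. f_imp P (f_mem_set P x F) (f_mem_set P x F'))"

definition f_subset_R ::
  "'p forcing \<Rightarrow> (nat \<Rightarrow> nat) \<Rightarrow> ('p real_name, 'p) name \<Rightarrow> 'p sentence" where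
  "f_subset_R P b F = f_all (real_names P) (\<lambda>x. f_imp P (f_mem_set P x F) (f_in_R P b x))"

definition f_captures ::
  "'p forcing \<Rightarrow> nat \<Rightarrow> nat set \<Rightarrow> ('p real_name, 'p) name \<Rightarrow> 'p sentence" where
  "f_captures P i v F = f_all (real_names P) (\<lambda>x. f_all UNIV (\<lambda>k.
     f_imp P (f_and (f_mem_set P x F) (f_mem P (i, k) x)) (f_abs (k \<in> v))))"

definition f_slalom_le ::
  "'p forcing \<Rightarrow> nat set list \<Rightarrow> ('p real_name, 'p) name \<Rightarrow> nat set list \<Rightarrow> ('p real_name, 'p) name
     \<Rightarrow> 'p sentence" where
  "f_slalom_le P s' F' s F = f_and (f_abs (prefix s s'))
     (f_and (f_subset P F F') (f_all {length s..<length s'} (\<lambda>i. f_captures P i (s' ! i) F)))"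

definition slaloms :: "(nat \<Rightarrow> nat) \<Rightarrow> (nat \<Rightarrow> nat) \<Rightarrow> nat set list set" where
  "slaloms b h = {s. \<forall>i<length s. s ! i \<subseteq> {..<b i} \<and> card (s ! i) \<le> h i}"

lemma finite_slalom: "s \<in> slaloms b h \<Longrightarrow> i < length s \<Longrightarrow> finite (s ! i)"
  unfolding slaloms_def by (auto intro: finite_subset[of _ "{..<b i}"])

lemma card_slalom_le: "s \<in> slaloms b h \<Longrightarrow> i < length s \<Longrightarrow> card (s ! i) \<le> h i"
  by (simp add: slaloms_def)

lemma slaloms_snoc:
  "s \<in> slaloms b h \<Longrightarrow> v \<subseteq> {..<b (length s)} \<Longrightarrow> card v \<le> h (length s) \<Longrightarrow> s @ [v] \<in> slaloms b h"
  by (auto simp: slaloms_def nth_append less_Suc_eq)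

lemma f_le_Q_eq:
  "f_le_Q P (\<sigma>', F') (\<sigma>, F) = f_ex P UNIV (\<lambda>s'. f_ex P UNIV (\<lambda>s.
     f_and (f_val P \<sigma>' s') (f_and (f_val P \<sigma> s) (f_slalom_le P s' F' s F))))"
  by (simp add: f_le_Q_def f_slalom_le_def f_subset_def f_captures_def)

lemma f_in_Q_eq:
  "f_in_Q P b h (\<sigma>, F) = f_ex P UNIV (\<lambda>s. f_and (f_val P \<sigma> s)
     (f_and (f_in_S P b h s) (f_and (f_subset_R P b F)
       (f_ex P UNIV (\<lambda>k. f_and (f_mem P (length s, k) h) (f_card_le P F k))))))"
  by (simp add: f_in_Q_def f_subset_R_def)

context preordered_forcing
begin

lemma regular_f_subset: "regular_sentence P (f_subset P F F')"
  unfolding f_subset_def by (intro regular_intros)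

lemma regular_f_subset_R: "regular_sentence P (f_subset_R P b F)"
  unfolding f_subset_R_def by (intro regular_intros regular_f_in_R)

lemma regular_f_captures: "regular_sentence P (f_captures P i v F)"
  unfolding f_captures_def by (intro regular_intros)

lemma regular_f_slalom_le: "regular_sentence P (f_slalom_le P s' F' s F)"
  unfolding f_slalom_le_def by (intro regular_intros regular_f_subset regular_f_captures)

lemma regular_f_in_S: "regular_sentence P (f_in_S P b h s)"
  unfolding f_in_S_def by (intro regular_intros)

lemma regular_f_card_le: "regular_sentence P (f_card_le P F n)"
  unfolding f_card_le_def by (rule regular_f_ex)

lemma regular_f_in_Q: "regular_sentence P (f_in_Q P b h q)"
  by (cases q) (simp add: f_in_Q_eq regular_f_ex)

lemma regular_f_le_Q: "regular_sentence P (f_le_Q P q' q)"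
  by (cases q; cases q') (simp add: f_le_Q_eq regular_f_ex)

lemma f_slalom_le_refl: "f_slalom_le P s F s F p"
  by (simp add: f_slalom_le_def f_subset_def forces_simps)

lemma f_slalom_le_trans:
  assumes "f_slalom_le P s3 F3 s2 F2 p" "f_slalom_le P s2 F2 s1 F1 p"
  shows "f_slalom_le P s3 F3 s1 F1 p"
proof -
  have prefix: "prefix s1 s2" "prefix s2 s3" and subset: "f_subset P F1 F2 p" "f_subset P F2 F3 p"
    using assms by (auto simp: f_slalom_le_def forces_simps)
  have "f_captures P i (s3 ! i) F1 p" if "length s1 \<le> i" "i < length s3" for i
  proof (cases "i < length s2")
    case True
    then have "s3 ! i = s2 ! i" using prefix(2) by (auto simp: prefix_def nth_append)
    then show ?thesis using assms(2) that True by (simp add: f_slalom_le_def forces_simps)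
  next
    case False
    then have "f_captures P i (s3 ! i) F2 p"
      using assms(1) that by (simp add: f_slalom_le_def forces_simps)
    then show ?thesis using subset(1) by (simp add: f_captures_def f_subset_def forces_simps)
  qed
  then show ?thesis
    using prefix subset by (auto simp: f_slalom_le_def f_subset_def forces_simps)
qed

lemma f_le_QI:
  assumes "f_val P \<sigma>' s' p" "f_val P \<sigma> s p" "f_slalom_le P s' F' s F p"
  shows "f_le_Q P (\<sigma>', F') (\<sigma>, F) p"
  unfolding f_le_Q_eq
  by (intro f_exI[of s'] f_exI[of s] regular_intros regular_f_val regular_f_slalom_le)
    (use assms in \<open>auto simp: forces_simps\<close>)

lemma f_le_QE:
  assumes "f_le_Q P (\<sigma>', F') (\<sigma>, F) p" "p \<in> conds P"
  obtains q s' s where "q \<preceq>\<^bsub>P\<^esub> p" "f_val P \<sigma>' s' q" "f_val P \<sigma> s q" "f_slalom_le P s' F' s F q"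
proof -
  obtain q1 s' where q1: "q1 \<preceq>\<^bsub>P\<^esub> p"
    "f_ex P UNIV (\<lambda>s. f_and (f_val P \<sigma>' s') (f_and (f_val P \<sigma> s) (f_slalom_le P s' F' s F))) q1"
    using assms unfolding f_le_Q_eq by (rule f_exE)
  then obtain q s where q: "q \<preceq>\<^bsub>P\<^esub> q1"
    "f_and (f_val P \<sigma>' s') (f_and (f_val P \<sigma> s) (f_slalom_le P s' F' s F)) q"
    using stronger_in_conds[OF q1(1)] by (elim f_exE)
  show ?thesis
    by (rule that[OF stronger_trans[OF q(1) q1(1)]]) (use q(2) in \<open>auto simp: forces_simps\<close>)
qed

lemma f_le_Q_iff:
  assumes "p \<in> conds P" "f_val P \<sigma>' s' p" "f_val P \<sigma> s p"
  shows "f_le_Q P (\<sigma>', F') (\<sigma>, F) p \<longleftrightarrow> f_slalom_le P s' F' s F p"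
proof
  assume le: "f_le_Q P (\<sigma>', F') (\<sigma>, F) p"
  from regular_f_slalom_le assms(1) show "f_slalom_le P s' F' s F p"
  proof (rule regular_sentence_dense)
    fix q assume q: "q \<preceq>\<^bsub>P\<^esub> p"
    obtain r u' u where r: "r \<preceq>\<^bsub>P\<^esub> q" "f_val P \<sigma>' u' r" "f_val P \<sigma> u r" "f_slalom_le P u' F' u F r"
      using regular_sentence_stronger[OF regular_f_le_Q le q] stronger_in_conds[OF q]
      by (rule f_le_QE)
    note val = regular_sentence_stronger[OF regular_f_val _ stronger_trans[OF r(1) q]]
    note unique = f_val_unique[OF stronger_in_conds[OF r(1)]]
    have "u' = s'" "u = s"
      by (rule unique[OF r(2) val[OF assms(2)]], rule unique[OF r(3) val[OF assms(3)]])
    then show "\<exists>r. r \<preceq>\<^bsub>P\<^esub> q \<and> f_slalom_le P s' F' s F r" using r(1,4) by auto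
  qed
qed (rule f_le_QI[OF assms(2,3)])

lemma f_le_Q_refl:
  assumes "p \<in> conds P" "f_in_Q P b h q p"
  shows "f_le_Q P q q p"
proof -
  obtain \<sigma> F where q: "q = (\<sigma>, F)" by (cases q)
  from assms(2)[unfolded q f_in_Q_eq] assms(1) regular_f_le_Q show ?thesis
    by (rule f_ex_elim_regular) (auto simp: q forces_simps intro: f_le_QI f_slalom_le_refl)
qed

lemma f_le_Q_trans:
  assumes "p \<in> conds P" "f_le_Q P q3 q2 p" "f_le_Q P q2 q1 p"
  shows "f_le_Q P q3 q1 p"
proof -
  obtain \<sigma>1 F1 \<sigma>2 F2 \<sigma>3 F3 where q: "q1 = (\<sigma>1, F1)" "q2 = (\<sigma>2, F2)" "q3 = (\<sigma>3, F3)"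
    by (cases q1; cases q2; cases q3) auto
  from regular_f_le_Q assms(1) show ?thesis
  proof (rule regular_sentence_dense)
    fix r assume r: "r \<preceq>\<^bsub>P\<^esub> p"
    obtain u s3 s2 where u: "u \<preceq>\<^bsub>P\<^esub> r" "f_val P \<sigma>3 s3 u" "f_val P \<sigma>2 s2 u"
        "f_slalom_le P s3 F3 s2 F2 u"
      using regular_sentence_stronger[OF regular_f_le_Q assms(2) r] stronger_in_conds[OF r]
      unfolding q by (rule f_le_QE)
    have "f_le_Q P q2 q1 u"
      using regular_sentence_stronger[OF regular_f_le_Q assms(3)] stronger_trans[OF u(1) r] .
    then obtain v s2' s1 where v: "v \<preceq>\<^bsub>P\<^esub> u" "f_val P \<sigma>2 s2' v" "f_val P \<sigma>1 s1 v"
        "f_slalom_le P s2' F2 s1 F1 v"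
      using stronger_in_conds[OF u(1)] unfolding q by (rule f_le_QE)
    note val = regular_sentence_stronger[OF regular_f_val _ v(1)]
    have "s2' = s2"
      using f_val_unique[OF stronger_in_conds[OF v(1)] v(2) val[OF u(3)]] .
    then have "f_slalom_le P s3 F3 s1 F1 v"
      using regular_sentence_stronger[OF regular_f_slalom_le u(4) v(1)] v(4) f_slalom_le_trans
      by blast
    then have "f_le_Q P q3 q1 v"
      using val[OF u(2)] v(3) unfolding q by (intro f_le_QI)
    then show "\<exists>v. v \<preceq>\<^bsub>P\<^esub> r \<and> f_le_Q P q3 q1 v"
      using stronger_trans[OF v(1) u(1)] by blast
  qed
qed

lemma f_subset_check_name: "Y \<subseteq> Z \<Longrightarrow> f_subset P (check_name P Y) (check_name P Z) p"
  by (auto simp: f_subset_def forces_simps intro: f_mem_set_check_name_mono)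

lemma f_subset_R_check_name:
  assumes "\<And>y. y \<in> Y \<Longrightarrow> f_in_R P b y p"
  shows "f_subset_R P b (check_name P Y) p"
proof -
  have "f_in_R P b x q" if q: "q \<preceq>\<^bsub>P\<^esub> p" "f_mem_set P x (check_name P Y) q" for q x
    using q(2)[unfolded f_mem_set_check_name] stronger_in_conds[OF q(1)] regular_f_in_R
  proof (rule f_ex_elim_regular)
    fix r y assume r: "r \<preceq>\<^bsub>P\<^esub> q" "y \<in> Y" "f_eq P x y r"
    then have "f_in_R P b y r"
      using assms q(1) stronger_trans regular_sentence_stronger[OF regular_f_in_R] by blast
    then show "f_in_R P b x r" using f_in_R_cong[OF r(3)] by blast
  qed
  then show ?thesis by (simp add: f_subset_R_def forces_simps)
qed

lemma f_card_le_check_name: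
  "set xs \<subseteq> real_names P \<Longrightarrow> length xs \<le> n \<Longrightarrow> f_card_le P (check_name P (set xs)) n p"
  unfolding f_card_le_def
  by (intro f_exI[of xs] regular_intros) (auto simp: forces_simps f_mem_set_check_name regular_f_eq)

lemma f_captures_check_name:
  assumes "\<And>x. x \<in> X \<Longrightarrow> f_value P x i (v x) p"
  shows "f_captures P i (v ` X) (check_name P X) p"
proof -
  have "k \<in> v ` X"
    if q: "q \<preceq>\<^bsub>P\<^esub> p" "f_mem_set P x (check_name P X) q" "f_mem P (i, k) x q" for x k q
  proof -
    obtain r y where r: "r \<preceq>\<^bsub>P\<^esub> q" "y \<in> X" "f_eq P x y r"
      using q(2) stronger_in_conds[OF q(1)] unfolding f_mem_set_check_name by (rule f_exE)
    have "f_mem P (i, k) x r"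
      using regular_sentence_stronger[OF regular_f_mem q(3) r(1)] .
    then have "f_mem P (i, k) y r"
      using f_eqD[OF r(3) stronger_refl[OF stronger_in_conds[OF r(1)]]] by blast
    then have "k = v y"
      using f_valueD[OF assms[OF r(2)] stronger_trans[OF r(1) q(1)]] by blast
    then show ?thesis using r(2) by blast
  qed
  then show ?thesis unfolding f_captures_def forces_simps by blast
qed

lemma f_captures_fun_name:
  assumes "f_captures P i v (check_name P X) p" "fun_name P x \<in> X" "p \<in> conds P"
  shows "x i \<in> v"
proof -
  have "f_mem P (i, x i) (fun_name P x) p" by (simp add: f_mem_fun_name assms(3))
  then show ?thesis
    using assms(1) fun_name_in_names f_mem_set_check_nameI[OF assms(2)] stronger_refl[OF assms(3)]
    unfolding f_captures_def forces_simps by blast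
qed

lemma f_ex_fun_name_value:
  assumes "p \<in> conds P" "regular_sentence P (\<Phi> (x i))"
  shows "f_ex P UNIV (\<lambda>k. f_and (f_mem P (i, k) (fun_name P x)) (\<Phi> k)) p \<longleftrightarrow> \<Phi> (x i) p"
  using assms
  by (intro f_ex_unique_iff regular_f_mem) (auto simp: f_mem_fun_name stronger_in_conds)

lemma f_in_S_fun_name: "p \<in> conds P \<Longrightarrow> f_in_S P b (fun_name P h) s p \<longleftrightarrow> s \<in> slaloms b h"
  by (simp add: f_in_S_def slaloms_def forces_simps f_ex_fun_name_value regular_f_abs Ball_def)

lemma f_in_Q_fun_name:
  assumes "p \<in> conds P" "f_val P \<sigma> s p"
  shows "f_in_Q P b (fun_name P h) (\<sigma>, F) p \<longleftrightarrow>
    s \<in> slaloms b h \<and> f_subset_R P b F p \<and> f_card_le P F (h (length s)) p"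
proof -
  have "f_in_Q P b (fun_name P h) (\<sigma>, F) p \<longleftrightarrow>
      f_and (f_in_S P b (fun_name P h) s) (f_and (f_subset_R P b F)
       (f_ex P UNIV (\<lambda>k. f_and (f_mem P (length s, k) (fun_name P h)) (f_card_le P F k)))) p"
    unfolding f_in_Q_eq using assms
    by (intro f_ex_unique_iff regular_intros regular_f_val regular_f_in_S regular_f_subset_R)
      (auto dest: f_val_unique regular_sentence_stronger[OF regular_f_val] stronger_in_conds)
  then show ?thesis
    by (simp add: forces_simps f_in_S_fun_name f_ex_fun_name_value regular_f_card_le assms(1))
qed

end

section \<open>The two-step iteration\<close>

lemma two_step_conds:
  "(p, q) \<in> conds (two_step P N in_Q le_Q) \<longleftrightarrow> p \<in> conds P \<and> q \<in> N \<and> in_Q q p"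
  by (simp add: two_step_def)

lemma two_step_stronger:
  "(p', q') \<preceq>\<^bsub>two_step P N in_Q le_Q\<^esub> (p, q) \<longleftrightarrow>
    p' \<preceq>\<^bsub>P\<^esub> p \<and> q' \<in> N \<and> in_Q q' p' \<and> le_Q q' q p'"
  by (auto simp: two_step_def stronger_def)

lemma (in preordered_forcing) preordered_forcing_two_step:
  assumes refl: "\<And>p q. p \<in> conds P \<Longrightarrow> q \<in> N \<Longrightarrow> in_Q q p \<Longrightarrow> le_Q q q p"
    and trans: "\<And>p q1 q2 q3. p \<in> conds P \<Longrightarrow> le_Q q3 q2 p \<Longrightarrow> le_Q q2 q1 p \<Longrightarrow> le_Q q3 q1 p"
    and regular: "\<And>q q'. regular_sentence P (le_Q q' q)"
  shows "preordered_forcing (two_step P N in_Q le_Q)"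
proof
  fix c assume "c \<in> conds (two_step P N in_Q le_Q)"
  then show "c \<preceq>\<^bsub>two_step P N in_Q le_Q\<^esub> c"
    by (cases c) (simp add: two_step_conds two_step_stronger refl stronger_refl)
next
  fix c3 c2 c1
  assume le: "c3 \<preceq>\<^bsub>two_step P N in_Q le_Q\<^esub> c2" "c2 \<preceq>\<^bsub>two_step P N in_Q le_Q\<^esub> c1"
  obtain p1 q1 p2 q2 p3 q3 where c: "c1 = (p1, q1)" "c2 = (p2, q2)" "c3 = (p3, q3)"
    by (cases c1; cases c2; cases c3) auto
  have p: "p3 \<preceq>\<^bsub>P\<^esub> p2" "p2 \<preceq>\<^bsub>P\<^esub> p1" and q: "le_Q q3 q2 p3" "le_Q q2 q1 p2"
    using le by (auto simp: c two_step_stronger)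
  have "le_Q q2 q1 p3" using regular q(2) p(1) by (rule regular_sentence_stronger)
  with stronger_in_conds[OF p(1)] q(1) have "le_Q q3 q1 p3" by (rule trans)
  then show "c3 \<preceq>\<^bsub>two_step P N in_Q le_Q\<^esub> c1"
    using le(1) stronger_trans[OF p] by (simp add: c two_step_stronger)
qed

locale slalom_iteration = preordered_forcing P for P :: "'p forcing" +
  fixes b h :: "nat \<Rightarrow> nat"
  assumes mono_h: "mono h"
begin

abbreviation iter :: "('p \<times> 'p slalom_name) forcing" where
  "iter \<equiv> two_step P (slalom_names P) (f_in_Q P b (fun_name P h)) (f_le_Q P)"

sublocale iter: preordered_forcing iter
  by (rule preordered_forcing_two_step)
    (erule (1) f_le_Q_refl, erule (2) f_le_Q_trans, rule regular_f_le_Q)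

text \<open>Normal conditions decide their working part \<^term>\<open>s\<close> and enumerate their promises as
  \<^term>\<open>xs\<close>.\<close>

definition normal :: "'p \<Rightarrow> nat set list \<Rightarrow> 'p real_name list \<Rightarrow> bool" where
  "normal p s xs \<longleftrightarrow> p \<in> conds P \<and> s \<in> slaloms b h \<and> length xs \<le> h (length s) \<and>
     set xs \<subseteq> real_names P \<and> (\<forall>x\<in>set xs. f_in_R P b x p)"

definition cond :: "'p \<Rightarrow> nat set list \<Rightarrow> 'p real_name list \<Rightarrow> 'p \<times> 'p slalom_name" where
  "cond p s xs = (p, check_name P {s}, check_name P (set xs))"

lemma cond_in_conds:
  assumes "normal p s xs"
  shows "cond p s xs \<in> conds iter"
proof -
  have "f_in_Q P b (fun_name P h) (check_name P {s}, check_name P (set xs)) p"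
    using assms f_in_Q_fun_name[OF _ f_val_check_name]
    by (simp add: normal_def f_subset_R_check_name f_card_le_check_name)
  then show ?thesis
    using assms
    by (simp add: cond_def two_step_conds normal_def slalom_names_def check_name_in_names)
qed

lemma cond_stronger_iff:
  assumes "normal p' s' xs'"
  shows "cond p' s' xs' \<preceq>\<^bsub>iter\<^esub> cond p s xs \<longleftrightarrow>
    p' \<preceq>\<^bsub>P\<^esub> p \<and> f_slalom_le P s' (check_name P (set xs')) s (check_name P (set xs)) p'"
  using cond_in_conds[OF assms] f_le_Q_iff[OF _ f_val_check_name f_val_check_name]
  by (auto simp: cond_def two_step_stronger two_step_conds)

lemma normal_dense:
  assumes "c \<in> conds iter"
  obtains p s xs where "normal p s xs" "cond p s xs \<preceq>\<^bsub>iter\<^esub> c"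
proof -
  obtain p0 \<sigma> F where c: "c = (p0, \<sigma>, F)" by (cases c)
  have p0: "f_in_Q P b (fun_name P h) (\<sigma>, F) p0" "p0 \<in> conds P"
    using assms by (auto simp: c two_step_conds)
  then obtain p1 s where p1: "p1 \<preceq>\<^bsub>P\<^esub> p0" "f_val P \<sigma> s p1"
    unfolding f_in_Q_eq by (rule f_exE) (auto simp: forces_simps intro: that)
  have "f_in_Q P b (fun_name P h) (\<sigma>, F) p1"
    using regular_sentence_stronger[OF regular_f_in_Q p0(1) p1(1)] .
  then have s: "s \<in> slaloms b h" and R: "f_subset_R P b F p1" and "f_card_le P F (h (length s)) p1"
    using f_in_Q_fun_name[OF stronger_in_conds[OF p1(1)] p1(2)] by auto
  then obtain p xs where p: "p \<preceq>\<^bsub>P\<^esub> p1" and xs: "length xs \<le> h (length s)" "set xs \<subseteq> real_names P"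
    and "f_all (real_names P) (\<lambda>x. f_iff P (f_mem_set P x F) (f_ex P (set xs) (f_eq P x))) p"
    using stronger_in_conds[OF p1(1)] unfolding f_card_le_def by (auto elim: f_exE)
  then have F: "f_mem_set P x F q \<longleftrightarrow> f_mem_set P x (check_name P (set xs)) q"
    if "x \<in> real_names P" "q \<preceq>\<^bsub>P\<^esub> p" for x q
    using that by (simp add: forces_simps f_mem_set_check_name)
  have "f_in_R P b x p" if "x \<in> set xs" for x
    using R p F[of x p] that xs(2) f_mem_set_check_nameI[OF that]
      stronger_refl[OF stronger_in_conds[OF p]]
    by (auto simp: f_subset_R_def forces_simps)
  then have normal: "normal p s xs"
    using s xs stronger_in_conds[OF p] by (simp add: normal_def)
  have "f_slalom_le P s (check_name P (set xs)) s F p"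
    by (simp add: f_slalom_le_def f_subset_def forces_simps F)
  then have "f_le_Q P (check_name P {s}, check_name P (set xs)) (\<sigma>, F) p"
    using f_val_check_name regular_sentence_stronger[OF regular_f_val p1(2) p] by (intro f_le_QI)
  then have "cond p s xs \<preceq>\<^bsub>iter\<^esub> c"
    using cond_in_conds[OF normal] stronger_trans[OF p p1(1)]
    by (simp add: c cond_def two_step_stronger two_step_conds)
  with normal show ?thesis by (rule that)
qed

lemma normal_strengthen:
  assumes "normal p s xs" "p' \<preceq>\<^bsub>P\<^esub> p"
  shows "normal p' s xs" and "cond p' s xs \<preceq>\<^bsub>iter\<^esub> cond p s xs"
proof -
  show normal: "normal p' s xs"
    using assms regular_sentence_stronger[OF regular_f_in_R] stronger_in_conds
    by (auto simp: normal_def)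
  show "cond p' s xs \<preceq>\<^bsub>iter\<^esub> cond p s xs"
    using assms(2) by (simp add: cond_stronger_iff[OF normal] f_slalom_le_refl)
qed

lemma normal_append:
  assumes "normal p s xs"
  obtains p' v where "normal p' (s @ [v]) xs" "cond p' (s @ [v]) xs \<preceq>\<^bsub>iter\<^esub> cond p s xs"
proof -
  have "p \<in> conds P" "\<And>x. x \<in> set xs \<Longrightarrow> f_ex P UNIV (f_value P x (length s)) p"
    using assms by (auto simp: normal_def f_in_R_def f_fun_eq forces_simps)
  then obtain q v where q: "q \<preceq>\<^bsub>P\<^esub> p" "\<forall>x\<in>set xs. f_value P x (length s) (v x) q"
    by (rule f_ex_finite_choice[where X = "set xs" and \<Phi> = "\<lambda>x. f_value P x (length s)",
          OF finite_set _ _ regular_f_value])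
  note normal_q = normal_strengthen(1)[OF assms q(1)]
  have "v ` set xs \<subseteq> {..<b (length s)}"
    using f_in_R_value_less[OF stronger_in_conds[OF q(1)]] q(2) normal_q
    by (auto simp: normal_def)
  moreover have "card (v ` set xs) \<le> h (length s)"
    using normal_q card_image_le[of "set xs" v] card_length[of xs] by (simp add: normal_def)
  moreover have "h (length s) \<le> h (Suc (length s))" using mono_h by (simp add: monoD)
  ultimately have normal: "normal q (s @ [v ` set xs]) xs"
    using normal_q by (simp add: normal_def slaloms_snoc)
  have "f_captures P (length s) (v ` set xs) (check_name P (set xs)) q"
    using q(2) by (intro f_captures_check_name) auto
  then have "f_slalom_le P (s @ [v ` set xs]) (check_name P (set xs)) s (check_name P (set xs)) q"
    by (simp add: f_slalom_le_def f_subset_check_name forces_simps)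
  then show ?thesis
    using that[OF normal] q(1) cond_stronger_iff[OF normal] by blast
qed

lemma normal_lengthen:
  assumes "normal p s xs"
  obtains p' s' where "normal p' s' xs" "N \<le> length s'" "cond p' s' xs \<preceq>\<^bsub>iter\<^esub> cond p s xs"
proof -
  have "\<exists>p' s'. normal p' s' xs \<and> N \<le> length s' \<and> cond p' s' xs \<preceq>\<^bsub>iter\<^esub> cond p s xs"
  proof (induction N)
    case 0
    then show ?case using assms iter.stronger_refl[OF cond_in_conds[OF assms]] by auto
  next
    case (Suc N)
    then obtain p' s' where p': "normal p' s' xs" "N \<le> length s'"
        "cond p' s' xs \<preceq>\<^bsub>iter\<^esub> cond p s xs"
      by blast
    obtain q v where "normal q (s' @ [v]) xs" "cond q (s' @ [v]) xs \<preceq>\<^bsub>iter\<^esub> cond p' s' xs"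
      using normal_append[OF p'(1)] .
    then show ?case
      using p'(2) iter.stronger_trans[OF _ p'(3)]
      by (intro exI[of _ q] exI[of _ "s' @ [v]"]) auto
  qed
  then show ?thesis using that by blast
qed

lemma normal_promise:
  assumes "normal p s xs" "length xs < h (length s)" "\<And>i. x i < b i"
  shows "normal p s (xs @ [fun_name P x])"
    and "cond p s (xs @ [fun_name P x]) \<preceq>\<^bsub>iter\<^esub> cond p s xs"
proof -
  show normal: "normal p s (xs @ [fun_name P x])"
    using assms by (auto simp: normal_def fun_name_in_names f_in_R_fun_name)
  have "p \<preceq>\<^bsub>P\<^esub> p" using assms(1) by (simp add: normal_def stronger_refl)
  moreover have "f_subset P (check_name P (set xs)) (check_name P (set (xs @ [fun_name P x]))) p"
    by (rule f_subset_check_name) auto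
  ultimately show "cond p s (xs @ [fun_name P x]) \<preceq>\<^bsub>iter\<^esub> cond p s xs"
    unfolding cond_stronger_iff[OF normal] by (simp add: f_slalom_le_def forces_simps)
qed

lemma cond_stronger_captures:
  assumes "normal p' s' xs'" "cond p' s' xs' \<preceq>\<^bsub>iter\<^esub> cond p s xs"
    and "fun_name P x \<in> set xs" "length s \<le> i" "i < length s'"
  shows "x i \<in> s' ! i"
proof -
  have "f_captures P i (s' ! i) (check_name P (set xs)) p'"
    using assms(2,4,5) by (simp add: cond_stronger_iff[OF assms(1)] f_slalom_le_def forces_simps)
  then show ?thesis using assms(1,3) f_captures_fun_name by (auto simp: normal_def)
qed

end

section \<open>Hechler forcing followed by slalom forcing\<close>

lemma hechler_conds: "(t, g) \<in> conds hechler \<longleftrightarrow> (\<forall>i<length t. t ! i = g i)"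
  by (simp add: hechler_def)

lemma hechler_stronger:
  "(t', g') \<preceq>\<^bsub>hechler\<^esub> (t, g) \<longleftrightarrow> (t', g') \<in> conds hechler \<and> prefix t t' \<and> (\<forall>n. g n \<le> g' n)"
  by (simp add: stronger_def hechler_def)

lemma preordered_forcing_hechler: "preordered_forcing hechler"
  by unfold_locales
    (auto simp: hechler_stronger, (meson prefix_order.trans order_trans)+)

lemma hechler_lengthen:
  assumes "(t, g) \<in> conds hechler"
  obtains t' where "(t', g) \<preceq>\<^bsub>hechler\<^esub> (t, g)" "N \<le> length t'"
proof
  let ?t = "map g [0..<max N (length t)]"
  have "take (length t) ?t = t"
    using assms by (intro nth_equalityI) (auto simp: hechler_conds)
  then have "prefix t ?t" by (metis take_is_prefix)
  then show "(?t, g) \<preceq>\<^bsub>hechler\<^esub> (t, g)" by (simp add: hechler_stronger hechler_conds)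
qed simp

lemma hechler_dominate:
  assumes "(t, g) \<in> conds hechler"
  obtains g' where "(t, g') \<preceq>\<^bsub>hechler\<^esub> (t, g)" "\<forall>j\<ge>length t. f j \<le> g' j"
proof
  let ?g = "\<lambda>j. if j < length t then g j else max (g j) (f j)"
  show "(t, ?g) \<preceq>\<^bsub>hechler\<^esub> (t, g)" using assms by (simp add: hechler_stronger hechler_conds)
qed simp

locale hechler_iteration = slalom_iteration hechler b h for b h :: "nat \<Rightarrow> nat" +
  assumes h_at_top: "filterlim h at_top sequentially"
begin

lemma normal_long_dense:
  assumes "c \<in> conds iter"
  obtains t g s xs where "normal (t, g) s xs" "N \<le> length t" "N \<le> length s"
    "cond (t, g) s xs \<preceq>\<^bsub>iter\<^esub> c"
proof -
  obtain p0 s0 xs where decided: "normal p0 s0 xs" "cond p0 s0 xs \<preceq>\<^bsub>iter\<^esub> c"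
    using normal_dense[OF assms] .
  obtain t1 g s where long: "normal (t1, g) s xs" "N \<le> length s"
      "cond (t1, g) s xs \<preceq>\<^bsub>iter\<^esub> cond p0 s0 xs"
    using normal_lengthen[OF decided(1)] by (metis surj_pair)
  obtain t where t: "(t, g) \<preceq>\<^bsub>hechler\<^esub> (t1, g)" "N \<le> length t"
    using hechler_lengthen long(1) unfolding normal_def by blast
  have "cond (t, g) s xs \<preceq>\<^bsub>iter\<^esub> c"
    using normal_strengthen(2)[OF long(1) t(1)] long(3) decided(2) iter.stronger_trans by metis
  then show ?thesis using that normal_strengthen(1)[OF long(1) t(1)] t(2) long(2) by blast
qed

lemma normal_dominating_dense:
  assumes "c \<in> conds iter"
  obtains t g s xs where "normal (t, g) s xs" "length xs < h (length s)"
    "\<forall>j\<ge>length t. f j \<le> g j" "cond (t, g) s xs \<preceq>\<^bsub>iter\<^esub> c"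
proof -
  obtain p0 s0 xs where decided: "normal p0 s0 xs" "cond p0 s0 xs \<preceq>\<^bsub>iter\<^esub> c"
    using normal_dense[OF assms] .
  obtain N where N: "Suc (length xs) \<le> h N"
    using h_at_top unfolding filterlim_at_top eventually_sequentially by blast
  obtain t g s where long: "normal (t, g) s xs" "N \<le> length s"
      "cond (t, g) s xs \<preceq>\<^bsub>iter\<^esub> cond p0 s0 xs"
    using normal_lengthen[OF decided(1)] by (metis surj_pair)
  obtain g' where g': "(t, g') \<preceq>\<^bsub>hechler\<^esub> (t, g)" "\<forall>j\<ge>length t. f j \<le> g' j"
    using hechler_dominate long(1) unfolding normal_def by metis
  have "h N \<le> h (length s)" using mono_h long(2) by (rule monoD)
  then have "length xs < h (length s)" using N by simp
  moreover have "cond (t, g') s xs \<preceq>\<^bsub>iter\<^esub> c"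
    using normal_strengthen(2)[OF long(1) g'(1)] long(3) decided(2) iter.stronger_trans by metis
  ultimately show ?thesis using that normal_strengthen(1)[OF long(1) g'(1)] g'(2) by blast
qed

lemma cond_stronger_prefix:
  assumes "normal (t', g') s' xs'" "cond (t', g') s' xs' \<preceq>\<^bsub>iter\<^esub> cond (t, g) s xs"
  shows "prefix t t'" "prefix s s'" "g n \<le> g' n"
  using assms(2)
  by (auto simp: cond_stronger_iff[OF assms(1)] hechler_stronger f_slalom_le_def forces_simps)

end

section \<open>Submeasures\<close>

lemma submeasure_on_mono: "submeasure_on u \<mu> \<Longrightarrow> x \<subseteq> y \<Longrightarrow> y \<subseteq> u \<Longrightarrow> \<mu> x \<le> \<mu> y"
  by (simp add: submeasure_on_def)

lemma submeasure_on_UN_le: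
  assumes "submeasure_on u \<mu>" "finite J" "\<And>j. j \<in> J \<Longrightarrow> Y j \<subseteq> u"
  shows "\<mu> (\<Union>j\<in>J. Y j) \<le> (\<Sum>j\<in>J. \<mu> (Y j))"
  using assms(2,3)
proof (induction J rule: finite_induct)
  case empty
  then show ?case using assms(1) by (simp add: submeasure_on_def)
next
  case (insert j J)
  then have "\<mu> (Y j \<union> (\<Union>j\<in>J. Y j)) \<le> \<mu> (Y j) + \<mu> (\<Union>j\<in>J. Y j)"
    using assms(1) by (simp add: submeasure_on_def UN_subset_iff)
  with insert show ?case by simp
qed

lemma finite_bounded_by_nat:
  fixes f :: "'i \<Rightarrow> real"
  assumes "finite I"
  obtains K :: nat where "\<And>i. i \<in> I \<Longrightarrow> f i \<le> real K"
proof -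
  obtain K :: nat where K: "(\<Sum>i\<in>I. \<bar>f i\<bar>) \<le> real K" using real_arch_simple by blast
  have "f i \<le> real K" if "i \<in> I" for i
    using member_le_sum[of i I "\<lambda>i. \<bar>f i\<bar>"] that assms K by simp
  then show ?thesis using that by blast
qed

lemma frag_ideal_bounded:
  assumes "x \<in> frag_ideal a \<phi>"
  shows "\<exists>k::nat. \<forall>i. \<phi> i (x \<inter> a i) \<le> real k"
proof -
  obtain M where M: "\<And>i. \<phi> i (x \<inter> a i) \<le> M"
    using assms by (auto simp: frag_ideal_def bdd_above_def)
  obtain k :: nat where "M \<le> real k" using real_arch_simple by blast
  then show ?thesis using M order_trans by blast
qed

definition bounded_unions ::
  "(nat \<Rightarrow> nat set) \<Rightarrow> (nat \<Rightarrow> nat set \<Rightarrow> real) \<Rightarrow> nat \<Rightarrow> nat \<Rightarrow> nat \<Rightarrow> nat \<Rightarrow> bool" where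
  "bounded_unions a \<phi> k m l i \<longleftrightarrow> (\<forall>Y. Y \<subseteq> Pow (a i) \<and> card Y \<le> l \<and> (\<forall>y\<in>Y. \<phi> i y \<le> real k)
     \<longrightarrow> \<phi> i (\<Union>Y) \<le> real m)"

definition fragmented_along ::
  "(nat \<Rightarrow> nat set) \<Rightarrow> (nat \<Rightarrow> nat set \<Rightarrow> real) \<Rightarrow> (nat \<Rightarrow> nat) \<Rightarrow> bool" where
  "fragmented_along a \<phi> h \<longleftrightarrow> (\<forall>k. \<exists>m. \<forall>\<^sub>\<infinity>i. bounded_unions a \<phi> k m (h i) i)"

lemma gradually_fragmented_iff:
  "gradually_fragmented a \<phi> \<longleftrightarrow> (\<forall>k. \<exists>m. \<forall>l. \<forall>\<^sub>\<infinity>i. bounded_unions a \<phi> k m l i)"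
  by (simp add: gradually_fragmented_def bounded_unions_def)

lemma eventually_diagonal:
  fixes R :: "nat \<Rightarrow> nat \<Rightarrow> bool"
  assumes "\<And>l. \<forall>\<^sub>\<infinity>i. R l i"
  obtains h where "mono h" "filterlim h at_top sequentially" "\<forall>\<^sub>\<infinity>i. R (h i) i"
proof -
  obtain T where T: "\<And>l i. T l \<le> i \<Longrightarrow> R l i"
    using assms unfolding MOST_nat_le by metis
  define L where "L i = {l. l \<le> i \<and> (l = 0 \<or> T l \<le> i)}" for i
  define h where "h i = Max (L i)" for i
  have finite: "finite (L i)" and nonempty: "L i \<noteq> {}" for i
    by (auto simp: L_def intro: finite_subset[of _ "{..i}"])
  have "mono h"
  proof
    fix i j :: nat assume "i \<le> j"
    then have "L i \<subseteq> L j" by (auto simp: L_def)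
    then show "h i \<le> h j" unfolding h_def by (rule Max_mono[OF _ nonempty finite])
  qed
  have "N \<le> h i" if "max N (T N) \<le> i" for N i
    using that finite unfolding h_def by (intro Max_ge) (auto simp: L_def)
  then have at_top: "filterlim h at_top sequentially"
    unfolding filterlim_at_top eventually_sequentially by blast
  have in_L: "h i \<in> L i" for i
    unfolding h_def using finite nonempty by (rule Max_in)
  have "R (h i) i" if "1 \<le> h i" for i
    using T in_L[of i] that by (auto simp: L_def)
  then have "\<forall>\<^sub>\<infinity>i. R (h i) i"
    using at_top unfolding filterlim_at_top eventually_sequentially MOST_nat_le by metis
  with \<open>mono h\<close> at_top show ?thesis by (rule that)
qed

lemma gradually_fragmented_along:
  assumes "gradually_fragmented a \<phi>"
  obtains h where "mono h" "filterlim h at_top sequentially" "fragmented_along a \<phi> h"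
proof -
  obtain m where m: "\<And>k l. \<forall>\<^sub>\<infinity>i. bounded_unions a \<phi> k (m k) l i"
    using assms unfolding gradually_fragmented_iff by metis
  then obtain h where h: "mono h" "filterlim h at_top sequentially"
    "\<forall>\<^sub>\<infinity>i. \<forall>k\<in>{..h i}. bounded_unions a \<phi> k (m k) (h i) i"
    using eventually_diagonal[of "\<lambda>l i. \<forall>k\<in>{..l}. bounded_unions a \<phi> k (m k) l i"]
    by (auto simp: eventually_ball_finite)
  have "\<forall>\<^sub>\<infinity>i. bounded_unions a \<phi> k (m k) (h i) i" for k
  proof -
    have "\<forall>\<^sub>\<infinity>i. k \<le> h i"
      using h(2) unfolding filterlim_at_top eventually_sequentially MOST_nat_le by blast
    with h(3) show ?thesis by eventually_elim simp
  qed
  then have "fragmented_along a \<phi> h" unfolding fragmented_along_def by blast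
  with h(1,2) show ?thesis by (rule that)
qed

section \<open>The separating set\<close>

definition f_trace :: "'p forcing \<Rightarrow> (nat \<Rightarrow> 'p sentence) \<Rightarrow> nat set \<Rightarrow> nat set \<Rightarrow> 'p sentence" where
  "f_trace P X u y = f_all u (\<lambda>n. f_iff P (X n) (f_abs (n \<in> y)))"

definition f_bounded_by ::
  "'p forcing \<Rightarrow> (nat \<Rightarrow> nat set) \<Rightarrow> (nat \<Rightarrow> nat set \<Rightarrow> real) \<Rightarrow> (nat \<Rightarrow> 'p sentence) \<Rightarrow> nat \<Rightarrow> 'p sentence"
where
  "f_bounded_by P a \<phi> X K = f_all UNIV (\<lambda>i. f_ex P (Pow (a i)) (\<lambda>y.
     f_and (f_trace P X (a i) y) (f_abs (\<phi> i y \<le> real K))))"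

lemma f_in_ideal_eq: "f_in_ideal P a \<phi> X = f_ex P UNIV (f_bounded_by P a \<phi> X)"
  by (simp add: f_in_ideal_def f_bounded_by_def[abs_def] f_trace_def)

lemma f_trace_inter:
  "f_trace P X u y p \<Longrightarrow> f_trace P (\<lambda>n. f_and (f_abs (n \<in> A)) (X n)) u (A \<inter> y) p"
  by (simp add: f_trace_def forces_simps)

lemma (in preordered_forcing) f_trace_diff:
  assumes "f_trace P X u y p"
  shows "f_trace P (\<lambda>n. f_and (f_abs (n \<in> B)) (f_not P (X n))) u (B \<inter> u - y) p"
proof -
  have "(\<forall>r. r \<preceq>\<^bsub>P\<^esub> q \<longrightarrow> \<not> X n r) \<longleftrightarrow> n \<notin> y" if "n \<in> u" "q \<preceq>\<^bsub>P\<^esub> p" for n q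
    using assms that stronger_refl[OF stronger_in_conds[OF that(2)]] stronger_trans[OF _ that(2)]
    by (auto simp: f_trace_def forces_simps)
  then show ?thesis by (simp add: f_trace_def forces_simps)
qed

lemma (in hechler_iteration) f_bounded_byI:
  assumes "\<And>t g s xs i.
    \<lbrakk>normal (t, g) s xs; cond (t, g) s xs \<preceq>\<^bsub>iter\<^esub> c; i < length t; i < length s\<rbrakk> \<Longrightarrow>
    \<exists>y\<subseteq>a i. f_trace iter X (a i) y (cond (t, g) s xs) \<and> \<phi> i y \<le> real K"
  shows "f_bounded_by iter a \<phi> X K c"
  unfolding f_bounded_by_def
proof (rule f_allI)
  fix i
  show "f_ex iter (Pow (a i)) (\<lambda>y. f_and (f_trace iter X (a i) y) (f_abs (\<phi> i y \<le> real K))) c"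
    unfolding f_ex_iff
  proof (intro allI impI)
    fix d assume d: "d \<preceq>\<^bsub>iter\<^esub> c"
    obtain t g s xs where e: "normal (t, g) s xs" "Suc i \<le> length t" "Suc i \<le> length s"
      "cond (t, g) s xs \<preceq>\<^bsub>iter\<^esub> d"
      using normal_long_dense[OF stronger_in_conds[OF d]] .
    then have "\<exists>y\<in>Pow (a i). f_and (f_trace iter X (a i) y) (f_abs (\<phi> i y \<le> real K))
        (cond (t, g) s xs)"
      using assms[OF e(1) iter.stronger_trans[OF e(4) d], of i] e(2,3)
      by (auto simp: forces_simps Suc_le_eq)
    then show "\<exists>r. r \<preceq>\<^bsub>iter\<^esub> d \<and> (\<exists>y\<in>Pow (a i).
        f_and (f_trace iter X (a i) y) (f_abs (\<phi> i y \<le> real K)) r)"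
      using e(4) by blast
  qed
qed

locale fragmented_gap =
  fixes a :: "nat \<Rightarrow> nat set" and \<phi> :: "nat \<Rightarrow> nat set \<Rightarrow> real" and h :: "nat \<Rightarrow> nat"
    and A :: "nat \<Rightarrow> nat set"
  assumes partition: "finite_partition a"
    and submeasure: "submeasure_on (a i) (\<phi> i)"
    and mono_h: "mono h"
    and h_at_top: "filterlim h at_top sequentially"
    and fragmented_along: "fragmented_along a \<phi> h"

sublocale fragmented_gap \<subseteq> hechler_iteration "\<lambda>i. Suc (set_encode (a i))" h
  using preordered_forcing_hechler mono_h h_at_top
  by (simp add: hechler_iteration_def hechler_iteration_axioms_def slalom_iteration_def
      slalom_iteration_axioms_def)

context fragmented_gap
begin

text \<open>For the Hechler real \<^term>\<open>d\<close> and the \<^term>\<open>i\<close>-th entry \<^term>\<open>v\<close> of the generic slalom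
  this is the part of the separating set inside \<^term>\<open>a i\<close>. Testing only \<^term>\<open>j \<le> i\<close> makes it
  depend on finitely many values of \<^term>\<open>d\<close>.\<close>

definition separator_piece :: "(nat \<Rightarrow> nat) \<Rightarrow> nat set \<Rightarrow> nat \<Rightarrow> nat set" where
  "separator_piece d v i = \<Union>{y \<in> set_decode ` v. y \<subseteq> a i \<and> (\<forall>j\<le>i. \<phi> i (A j \<inter> y) \<le> real (d j))}"

definition remainder_code :: "nat set \<Rightarrow> nat \<Rightarrow> nat \<Rightarrow> nat" where
  "remainder_code B n i = set_encode ((B - (\<Union>j<n. A j)) \<inter> a i)"

definition separator_name ::
  "(nat, (nat list \<times> (nat \<Rightarrow> nat)) \<times> (nat list \<times> (nat \<Rightarrow> nat)) slalom_name) name" where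
  "separator_name = {(n, cond (t, g) s xs) | n t g s xs i. normal (t, g) s xs \<and>
     i < length t \<and> i < length s \<and> n \<in> separator_piece ((!) t) (s ! i) i}"

lemma finite_block: "finite (a i)"
  using partition by (simp add: finite_partition_def)

lemma blocks_disjoint: "n \<in> a i \<Longrightarrow> n \<in> a j \<Longrightarrow> i = j"
  using partition by (auto simp: finite_partition_def disjoint_family_on_def)

lemma separator_piece_in_block: "n \<in> separator_piece d v i \<Longrightarrow> n \<in> a i"
  by (auto simp: separator_piece_def)

lemma inter_separator_piece_bounded:
  "\<exists>K::nat. \<forall>i d v. d l = k \<longrightarrow> finite v \<longrightarrow> card v \<le> h i \<longrightarrow>
     \<phi> i (A l \<inter> separator_piece d v i) \<le> real K"
proof -
  obtain m N where m: "\<And>i. N \<le> i \<Longrightarrow> bounded_unions a \<phi> k m (h i) i"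
    using fragmented_along unfolding fragmented_along_def MOST_nat_le by metis
  obtain K where K: "\<And>i. i \<in> {..<max N l} \<Longrightarrow> \<phi> i (a i) \<le> real K"
    using finite_bounded_by_nat[of "{..<max N l}" "\<lambda>i. \<phi> i (a i)"] by blast
  have "\<phi> i (A l \<inter> separator_piece d v i) \<le> real (max m K)"
    if d: "d l = k" and v: "finite v" "card v \<le> h i" for i d v
  proof (cases "i < max N l")
    case True
    have "\<phi> i (A l \<inter> separator_piece d v i) \<le> \<phi> i (a i)"
      using separator_piece_in_block by (intro submeasure_on_mono[OF submeasure]) auto
    then show ?thesis using K[of i] True by simp
  next
    case False
    define Y where
      "Y = (\<inter>) (A l) ` {y \<in> set_decode ` v. y \<subseteq> a i \<and> (\<forall>j\<le>i. \<phi> i (A j \<inter> y) \<le> real (d j))}"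
    have "Y \<subseteq> (\<lambda>c. A l \<inter> set_decode c) ` v" by (auto simp: Y_def)
    with v(1) have "card Y \<le> card v" by (rule surj_card_le)
    moreover have "Y \<subseteq> Pow (a i)" "\<forall>y\<in>Y. \<phi> i y \<le> real k" using False d by (auto simp: Y_def)
    ultimately have "\<phi> i (\<Union>Y) \<le> real m"
      using m[of i] False v(2) by (simp add: bounded_unions_def)
    moreover have "A l \<inter> separator_piece d v i = \<Union>Y" by (auto simp: Y_def separator_piece_def)
    ultimately show ?thesis by simp
  qed
  then show ?thesis by blast
qed

lemma remainder_code_less: "remainder_code B n i < Suc (set_encode (a i))"
  unfolding remainder_code_def set_encode_def less_Suc_eq_le
  using finite_block by (intro sum_mono2) auto

lemma diff_separator_piece_le:
  assumes captured: "remainder_code B n i \<in> v"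
    and bound: "\<And>j. \<phi> i (A j \<inter> B \<inter> a i) \<le> real (f j)"
    and dominated: "\<And>j. n \<le> j \<Longrightarrow> j \<le> i \<Longrightarrow> f j \<le> d j"
  shows "\<phi> i (B \<inter> a i - separator_piece d v i) \<le> real (\<Sum>j<n. f j)"
proof -
  let ?B = "(B - (\<Union>j<n. A j)) \<inter> a i"
  have test: "\<phi> i (A j \<inter> ?B) \<le> real (d j)" if "j \<le> i" for j
  proof (cases "j < n")
    case True
    then have "A j \<inter> ?B = {}" by auto
    then show ?thesis using submeasure[of i] by (simp add: submeasure_on_def)
  next
    case False
    have "\<phi> i (A j \<inter> ?B) \<le> \<phi> i (A j \<inter> B \<inter> a i)"
      using submeasure by (rule submeasure_on_mono) auto
    also have "\<dots> \<le> real (f j)" by (rule bound)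
    finally show ?thesis using dominated[of j] False that by simp
  qed
  have "?B \<in> set_decode ` v"
    using finite_block by (intro image_eqI[OF _ captured]) (simp add: remainder_code_def)
  then have "?B \<subseteq> separator_piece d v i" using test by (auto simp: separator_piece_def)
  then have "B \<inter> a i - separator_piece d v i \<subseteq> (\<Union>j<n. A j \<inter> B \<inter> a i)" by auto
  then have "\<phi> i (B \<inter> a i - separator_piece d v i) \<le> \<phi> i (\<Union>j<n. A j \<inter> B \<inter> a i)"
    using submeasure by (intro submeasure_on_mono) auto
  also have "\<dots> \<le> (\<Sum>j<n. \<phi> i (A j \<inter> B \<inter> a i))"
    by (rule submeasure_on_UN_le[OF submeasure]) auto
  also have "\<dots> \<le> real (\<Sum>j<n. f j)" by (simp add: bound sum_mono)
  finally show ?thesis .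
qed

lemma separator_piece_stronger:
  assumes "normal (t', g') s' xs'" "cond (t', g') s' xs' \<preceq>\<^bsub>iter\<^esub> cond (t, g) s xs"
    and "i < length t" "i < length s"
  shows "separator_piece ((!) t') (s' ! i) i = separator_piece ((!) t) (s ! i) i"
proof -
  have "s' ! i = s ! i" "\<And>j. j \<le> i \<Longrightarrow> t' ! j = t ! j"
    using cond_stronger_prefix(1,2)[OF assms(1,2)] assms(3,4) by (auto simp: prefix_def nth_append)
  then show ?thesis by (simp add: separator_piece_def)
qed

lemma f_trace_separator_name:
  assumes "normal (t, g) s xs" "i < length t" "i < length s"
  shows "f_trace iter (\<lambda>n. f_mem iter n separator_name) (a i) (separator_piece ((!) t) (s ! i) i)
    (cond (t, g) s xs)"
proof -
  have "f_mem iter n separator_name c \<longleftrightarrow> n \<in> separator_piece ((!) t) (s ! i) i"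
    if "n \<in> a i" and c: "c \<preceq>\<^bsub>iter\<^esub> cond (t, g) s xs" for n c
  proof
    assume "f_mem iter n separator_name c"
    then obtain c1 d where c1: "c1 \<preceq>\<^bsub>iter\<^esub> c" "(n, d) \<in> separator_name" "le iter c1 d"
      using iter.stronger_refl[OF stronger_in_conds[OF c]] iter.stronger_trans
      unfolding f_mem_def dense_below_iff by blast
    then obtain t1 g1 s1 xs1 j where d: "d = cond (t1, g1) s1 xs1" "j < length t1" "j < length s1"
        "n \<in> separator_piece ((!) t1) (s1 ! j) j"
      unfolding separator_name_def by blast
    have "j = i" using blocks_disjoint \<open>n \<in> a i\<close> d(4) separator_piece_in_block by blast
    obtain t2 g2 s2 xs2 where c2: "normal (t2, g2) s2 xs2" "cond (t2, g2) s2 xs2 \<preceq>\<^bsub>iter\<^esub> c1"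
      using normal_dense[OF stronger_in_conds[OF c1(1)]] by (metis surj_pair)
    have "c1 \<preceq>\<^bsub>iter\<^esub> d" using c1 by (simp add: stronger_def)
    then have "separator_piece ((!) t2) (s2 ! i) i = separator_piece ((!) t1) (s1 ! i) i"
      using d(2,3) iter.stronger_trans[OF c2(2)] unfolding d(1) \<open>j = i\<close>
      by (intro separator_piece_stronger[OF c2(1)])
    moreover have "separator_piece ((!) t2) (s2 ! i) i = separator_piece ((!) t) (s ! i) i"
      using iter.stronger_trans[OF iter.stronger_trans[OF c2(2) c1(1)] c] assms(2,3)
      by (rule separator_piece_stronger[OF c2(1)])
    ultimately show "n \<in> separator_piece ((!) t) (s ! i) i" using d(4) \<open>j = i\<close> by simp
  next
    assume "n \<in> separator_piece ((!) t) (s ! i) i"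
    then have mem: "(n, cond (t, g) s xs) \<in> separator_name"
      using assms unfolding separator_name_def by blast
    have "d \<preceq>\<^bsub>iter\<^esub> d \<and> le iter d (cond (t, g) s xs)" if "d \<preceq>\<^bsub>iter\<^esub> c" for d
      using iter.stronger_refl[OF stronger_in_conds[OF that]] iter.stronger_trans[OF that c]
      by (simp add: stronger_def)
    then show "f_mem iter n separator_name c"
      unfolding f_mem_def dense_below_iff using mem by blast
  qed
  then show ?thesis by (simp add: f_trace_def forces_simps)
qed

lemma inter_separator_in_ideal:
  "f_in_ideal iter a \<phi> (\<lambda>n. f_and (f_abs (n \<in> A l)) (f_mem iter n separator_name)) c"
  (is "f_in_ideal iter a \<phi> ?X c")
  unfolding f_in_ideal_eq f_ex_iff
proof (intro allI impI)
  fix c1 assume "c1 \<preceq>\<^bsub>iter\<^esub> c"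
  then obtain t0 g0 s0 xs0 where c0: "normal (t0, g0) s0 xs0" "Suc l \<le> length t0"
      "cond (t0, g0) s0 xs0 \<preceq>\<^bsub>iter\<^esub> c1"
    using normal_long_dense[OF stronger_in_conds] by metis
  obtain K :: nat where K: "\<And>i d v. \<lbrakk>d l = t0 ! l; finite v; card v \<le> h i\<rbrakk> \<Longrightarrow>
      \<phi> i (A l \<inter> separator_piece d v i) \<le> real K"
    using inter_separator_piece_bounded[of l "t0 ! l"] by blast
  have "f_bounded_by iter a \<phi> ?X K (cond (t0, g0) s0 xs0)"
  proof (rule f_bounded_byI)
    fix t g s xs i
    assume below: "normal (t, g) s xs" "cond (t, g) s xs \<preceq>\<^bsub>iter\<^esub> cond (t0, g0) s0 xs0"
      and i: "i < length t" "i < length s"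
    let ?y = "A l \<inter> separator_piece ((!) t) (s ! i) i"
    have "t ! l = t0 ! l"
      using cond_stronger_prefix(1)[OF below] c0(2) by (auto simp: prefix_def nth_append)
    moreover have "finite (s ! i)" "card (s ! i) \<le> h i"
      using below(1) i(2) by (auto simp: normal_def intro: finite_slalom card_slalom_le)
    ultimately have "\<phi> i ?y \<le> real K" by (rule K)
    moreover have "?y \<subseteq> a i" using separator_piece_in_block by blast
    ultimately show "\<exists>y\<subseteq>a i. f_trace iter ?X (a i) y (cond (t, g) s xs) \<and> \<phi> i y \<le> real K"
      by (intro exI[of _ ?y] conjI f_trace_inter f_trace_separator_name[OF below(1) i])
  qed
  then show "\<exists>r. r \<preceq>\<^bsub>iter\<^esub> c1 \<and> (\<exists>K\<in>UNIV. f_bounded_by iter a \<phi> ?X K r)" using c0(3) by blast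
qed

lemma diff_separator_piece_le_below_promise:
  assumes "normal (t, g) s xs" "cond (t, g) s xs \<preceq>\<^bsub>iter\<^esub> cond (t0, g0) s0 ys"
    and promised: "fun_name hechler (remainder_code B (length t0)) \<in> set ys"
    and "length s0 \<le> i" "i < length t" "i < length s"
    and bound: "\<And>j. \<phi> i (A j \<inter> B \<inter> a i) \<le> real (f j)"
    and dominated: "\<forall>j\<ge>length t0. f j \<le> g0 j"
  shows "\<phi> i (B \<inter> a i - separator_piece ((!) t) (s ! i) i) \<le> real (\<Sum>j<length t0. f j)"
proof (rule diff_separator_piece_le)
  show "remainder_code B (length t0) i \<in> s ! i"
    using cond_stronger_captures[OF assms(1,2) promised assms(4,6)] .
  show "f j \<le> t ! j" if "length t0 \<le> j" "j \<le> i" for j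
  proof -
    have "f j \<le> g0 j" using dominated that(1) by simp
    also have "g0 j \<le> g j" by (rule cond_stronger_prefix(3)[OF assms(1,2)])
    also have "g j = t ! j" using assms(1,5) that(2) by (simp add: normal_def hechler_conds)
    finally show ?thesis .
  qed
qed (rule bound)

lemma diff_separator_bounded_below_promise:
  assumes promised: "fun_name hechler (remainder_code B (length t0)) \<in> set ys"
    and bound: "\<And>i j. \<phi> i (A j \<inter> B \<inter> a i) \<le> real (f j)"
    and dominated: "\<forall>j\<ge>length t0. f j \<le> g0 j"
  obtains K where "f_bounded_by iter a \<phi>
    (\<lambda>n. f_and (f_abs (n \<in> B)) (f_not iter (f_mem iter n separator_name))) K (cond (t0, g0) s0 ys)"
proof -
  obtain K where K: "\<And>i. i \<in> {..<length s0} \<Longrightarrow> \<phi> i (a i) \<le> real K"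
    using finite_bounded_by_nat[of "{..<length s0}" "\<lambda>i. \<phi> i (a i)"] by blast
  show ?thesis
  proof (rule that, rule f_bounded_byI)
    fix t g s xs i
    assume below: "normal (t, g) s xs" "cond (t, g) s xs \<preceq>\<^bsub>iter\<^esub> cond (t0, g0) s0 ys"
      and i: "i < length t" "i < length s"
    let ?y = "B \<inter> a i - separator_piece ((!) t) (s ! i) i"
    have "\<phi> i ?y \<le> real (max K (\<Sum>j<length t0. f j))"
    proof (cases "i < length s0")
      case True
      have "\<phi> i ?y \<le> \<phi> i (a i)" using submeasure by (rule submeasure_on_mono) auto
      then show ?thesis using K[of i] True by simp
    next
      case False
      then have "\<phi> i ?y \<le> real (\<Sum>j<length t0. f j)"
        using i promised bound dominated
        by (intro diff_separator_piece_le_below_promise[OF below]) auto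
      then show ?thesis by linarith
    qed
    then show "\<exists>y\<subseteq>a i. f_trace iter (\<lambda>n. f_and (f_abs (n \<in> B))
        (f_not iter (f_mem iter n separator_name))) (a i) y (cond (t, g) s xs) \<and>
        \<phi> i y \<le> real (max K (\<Sum>j<length t0. f j))"
      using iter.f_trace_diff[OF f_trace_separator_name[OF below(1) i], of B]
      by (intro exI[of _ ?y]) auto
  qed
qed

lemma diff_separator_in_ideal:
  assumes "\<And>j. A j \<inter> B \<in> frag_ideal a \<phi>"
  shows "f_in_ideal iter a \<phi>
      (\<lambda>n. f_and (f_abs (n \<in> B)) (f_not iter (f_mem iter n separator_name))) c"
    (is "f_in_ideal iter a \<phi> ?X c")
  unfolding f_in_ideal_eq f_ex_iff
proof (intro allI impI)
  fix c1 assume c1: "c1 \<preceq>\<^bsub>iter\<^esub> c"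
  obtain f :: "nat \<Rightarrow> nat" where f: "\<And>i j. \<phi> i (A j \<inter> B \<inter> a i) \<le> real (f j)"
    using frag_ideal_bounded[OF assms] by metis
  obtain t0 g0 s0 xs where c0: "normal (t0, g0) s0 xs" "length xs < h (length s0)"
      "\<forall>j\<ge>length t0. f j \<le> g0 j" "cond (t0, g0) s0 xs \<preceq>\<^bsub>iter\<^esub> c1"
    using normal_dominating_dense[OF stronger_in_conds[OF c1], of f] .
  define ys where "ys = xs @ [fun_name hechler (remainder_code B (length t0))]"
  have "cond (t0, g0) s0 ys \<preceq>\<^bsub>iter\<^esub> cond (t0, g0) s0 xs"
    unfolding ys_def using c0(1,2) remainder_code_less by (rule normal_promise(2))
  then have "cond (t0, g0) s0 ys \<preceq>\<^bsub>iter\<^esub> c1" using c0(4) by (rule iter.stronger_trans)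
  moreover have "fun_name hechler (remainder_code B (length t0)) \<in> set ys" by (simp add: ys_def)
  then obtain K where "f_bounded_by iter a \<phi> ?X K (cond (t0, g0) s0 ys)"
    using f c0(3) by (rule diff_separator_bounded_below_promise)
  ultimately show "\<exists>r. r \<preceq>\<^bsub>iter\<^esub> c1 \<and> (\<exists>K\<in>UNIV. f_bounded_by iter a \<phi> ?X K r)" by blast
qed

lemma separation_forced:
  assumes "\<A> \<subseteq> range A" "orthogonal_wrt (frag_ideal a \<phi>) (range A) \<B>"
  shows "forced iter (f_ex iter (names iter UNIV) (f_separates iter a \<phi> \<A> \<B>))"
proof -
  have "f_separates iter a \<phi> \<A> \<B> separator_name c" for c
    unfolding f_separates_def
  proof (intro f_andI f_allI)
    fix X assume "X \<in> \<A>"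
    then obtain l where "X = A l" using assms(1) by blast
    then show "f_in_ideal iter a \<phi> (\<lambda>n. f_and (f_abs (n \<in> X)) (f_mem iter n separator_name)) c"
      by (simp add: inter_separator_in_ideal)
  qed (use assms(2) in \<open>auto simp: orthogonal_wrt_def intro: diff_separator_in_ideal\<close>)
  moreover have "separator_name \<in> names iter UNIV"
    by (auto simp: names_def separator_name_def cond_in_conds)
  ultimately show ?thesis
    unfolding forced_def f_ex_iff by (metis iter.stronger_refl stronger_in_conds)
qed

end

theorem theorem4p3:
  fixes a :: "nat \<Rightarrow> nat set" and \<phi> :: "nat \<Rightarrow> nat set \<Rightarrow> real"
  assumes "finite_partition a"
    and "\<And>i. submeasure_on (a i) (\<phi> i)"
    and "gradually_fragmented a \<phi>"
  shows "\<exists>b :: nat \<Rightarrow> nat. (\<forall>i. b i > 0) \<and>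
    (\<exists>h \<in> real_names hechler.
       forced hechler
         (f_and (f_fun hechler h) (f_and (f_nondecreasing hechler h) (f_to_infinity hechler h))) \<and>
       (\<forall>\<A> \<B>. orthogonal_wrt (frag_ideal a \<phi>) \<A> \<B> \<and> countable \<A> \<longrightarrow>
          forced (hechler_slalom b h)
            (f_ex (hechler_slalom b h) (names (hechler_slalom b h) UNIV)
               (\<lambda>C. f_separates (hechler_slalom b h) a \<phi> \<A> \<B> C))))"
proof -
  obtain h where h: "mono h" "filterlim h at_top sequentially" "fragmented_along a \<phi> h"
    using gradually_fragmented_along[OF assms(3)] .
  interpret hechler: preordered_forcing hechler by (rule preordered_forcing_hechler)
  show ?thesis
  proof (intro exI[of _ "\<lambda>i. Suc (set_encode (a i))"] conjI bexI[of _ "fun_name hechler h"]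
      allI impI)
    fix \<A> \<B> assume gap: "orthogonal_wrt (frag_ideal a \<phi>) \<A> \<B> \<and> countable \<A>"
    have "{} \<in> frag_ideal a \<phi>" using assms(2) by (simp add: frag_ideal_def submeasure_on_def)
    then have orthogonal: "orthogonal_wrt (frag_ideal a \<phi>) (insert {} \<A>) \<B>"
      using gap by (simp add: orthogonal_wrt_def)
    have range: "range (from_nat_into (insert {} \<A>)) = insert {} \<A>"
      using gap by (intro range_from_nat_into) auto
    interpret fragmented_gap a \<phi> h "from_nat_into (insert {} \<A>)"
      using assms(1,2) h by unfold_locales
    show "forced iter (f_ex iter (names iter UNIV) (f_separates iter a \<phi> \<A> \<B>))"
      using separation_forced orthogonal unfolding range by blast
  qed (simp_all add: forced_def forces_simps h hechler.f_fun_fun_name fun_name_in_names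
      hechler.f_nondecreasing_fun_name hechler.f_to_infinity_fun_name)
qed

end
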